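(* Let $\delta\in(0,1/4)$, $c=10^{-10}\delta$, and let $r,t,k,n$ be positive integers with $r\le k$ and $n>(2t+1)(k+r)-t$. If $\mathcal{A}\subset\binom{[n]}{k}$ has no matching of size $t+1$ and $|\mathcal{A}|>\binom nk-(1+\frac{rc}{n})\binom{n-t}{k}$, then there is $T\in\binom{[n]}{t}$ such that $|\mathcal{A}\triangle\mathcal{S}_T|<3\delta\binom{n-t-1}{k-1}$.
   Context: A matching of size $s$ in $\mathcal{A}$ is a collection of $s$ pairwise disjoint members of $\mathcal{A}$. For $T\subset[n]$, $\mathcal{S}_T=\{A\in\binom{[n]}{k}: A\cap T\neq\emptyset\}$. *)

theory Defs
  imports Complex_Main "HOL-Library.Disjoint_Sets" "HOL-Library.Ramsey"
begin

definition matching_in :: "'a set set \<Rightarrow> nat \<Rightarrow> 'a set set \<Rightarrow> bool" where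
  "matching_in \<A> s M \<longleftrightarrow> M \<subseteq> \<A> \<and> finite M \<and> card M = s \<and> disjoint M"

text \<open>The family \<open>\<S>\<^sub>T\<close>; the dependence on \<open>n\<close> and \<open>k\<close>, implicit in
  the notation, is made explicit. The \<open>k\<close>-subsets of \<open>[n]\<close> are \<^term>\<open>nsets {1..n} k\<close>.\<close>

definition star_family :: "nat \<Rightarrow> nat \<Rightarrow> nat set \<Rightarrow> nat set set" where
  "star_family n k T = {A \<in> nsets {1..n} k. A \<inter> T \<noteq> {}}"

end

theory Submission
  imports Defs "HOL-Analysis.Convex" "HOL-Combinatorics.Permutations"
begin

text \<open>For a left-shifted family, let \<open>\<G>\<^sub>1 \<supseteq> \<dots> \<supseteq> \<G>\<^sub>t\<^sub>+\<^sub>1\<close> be the links of the points \<open>1, \<dots>, t + 1\<close> in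
  \<open>Y = {t + 2, \<dots>, n}\<close>. Frankl's argument, run with \<open>2 t + 1\<close> random disjoint sets of size \<open>k + r - 1\<close>
  instead of \<open>k - 1\<close>, bounds the upper shadows of the links, and the upper shadow of \<open>\<G>\<^sub>t\<^sub>+\<^sub>1\<close> is denser than
  \<open>\<G>\<^sub>t\<^sub>+\<^sub>1\<close> by a factor bounded below in terms of \<open>r / k\<close>; hence a nearly extremal shifted family has a tiny
  \<open>\<G>\<^sub>t\<^sub>+\<^sub>1\<close> and is close to the star of \<open>{1, \<dots>, t}\<close>.

  Shifts are undone one at a time. If \<open>S\<^sub>i\<^sub>j(\<A>)\<close> is close to the star of \<open>T\<close>, only \<open>i \<in> T\<close>, \<open>j \<notin> T\<close> is
  a problem; then the links of \<open>i\<close> and \<open>j\<close> in \<open>\<A>\<close> cover almost everything but span almost no disjoint pair,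
  so by expansion of the disjointness graph one of them is small, and \<open>\<A>\<close> is roughly close to the star of \<open>T\<close>
  or of \<open>T - {i} \<union> {j}\<close>. The same expansion shows that a family roughly close to a star loses
  more inside the star than it gains outside, so near-extremality restores the original precision and errors
  do not accumulate.\<close>

section \<open>Expansion of the disjointness graph\<close>

text \<open>Blocks of size \<open>k - 1\<close> give only the sharp bound. Let g be the density of
  the last link and D = \<open>(n - t - 1) choose (k - 1)\<close>. Then at least (t + 1) g D sets
  are missing from the star, and at most (t + 1) g D lie outside it. Larger blocks replace g by the
  density v of the upper shadow in the first estimate but not in the second. The surplus (t + 1)(v -
  g) is at least (t + 1) g r / (4 k), while the allowed deficit is r c / k in units of D; the factor
  r / k cancels and leaves (t + 1) g < 4 c. This is why the error term of the hypothesis is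
  proportional to \<open>r\<close>.

  Undoing one shift degrades the precision from 1/1000 to 1/10, and the number of shifts has no
  bound in terms of \<open>c\<close>. Recovery needs a gain outside the star strictly smaller than
  the loss inside. A union bound over the missing links does not give this, since k-sets outnumber
  (k - 1)-sets by a factor of about n / k; the second-order term of the mixing inequality, of order
  (k / n)^2, does.\<close>

lemma log_convex_bound:
  fixes v :: "nat \<Rightarrow> real"
  assumes nonneg: "\<And>m. 0 \<le> v m" and conv: "\<And>m. (v (Suc m))\<^sup>2 \<le> v m * v (Suc (Suc m))"
    and bound: "\<And>m. v m \<le> C * q ^ m" and q: "0 \<le> q"
  shows "v 1 \<le> q * v 0"
proof (cases "v 0 = 0 \<or> v 1 = 0")
  case True
  then show ?thesis using conv[of 0] nonneg[of 0] q by auto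
next
  case False
  define \<rho> where "\<rho> = v 1 / v 0"
  have pos: "v 0 > 0" "v 1 > 0" using False nonneg[of 0] nonneg[of 1] by linarith+
  then have \<rho>: "\<rho> > 0" by (simp add: \<rho>_def)
  \<comment> \<open>The ratios \<open>v (Suc m) / v m\<close> never decrease, so \<open>v\<close>
    grows at least like powers of the first ratio \<open>\<rho>\<close>; a \<open>\<rho>\<close>
    above \<open>q\<close> would outrun every multiple of \<open>q ^ m\<close>.\<close>
  have step: "v m > 0 \<and> v (Suc m) \<ge> \<rho> * v m" for m
  proof (induction m)
    case 0
    then show ?case using pos by (simp add: \<rho>_def)
  next
    case (Suc m)
    then have a: "v m > 0" "v (Suc m) \<ge> \<rho> * v m" by auto
    then have b: "v (Suc m) > 0" using \<rho> by (meson less_le_trans mult_pos_pos)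
    have "\<rho> * v m * v (Suc m) \<le> v (Suc m) * v (Suc m)"
      using a b by (intro mult_right_mono) auto
    also have "\<dots> \<le> v m * v (Suc (Suc m))" using conv[of m] by (simp add: power2_eq_square)
    finally have "v m * (\<rho> * v (Suc m)) \<le> v m * v (Suc (Suc m))" by (simp add: mult_ac)
    then have "\<rho> * v (Suc m) \<le> v (Suc (Suc m))" using a(1) by simp
    with b show ?case by simp
  qed
  have pw: "v 0 * \<rho> ^ m \<le> v m" for m
  proof (induction m)
    case (Suc m)
    have "v 0 * \<rho> ^ Suc m = \<rho> * (v 0 * \<rho> ^ m)" by simp
    also have "\<dots> \<le> \<rho> * v m" using Suc \<rho> by (intro mult_left_mono) auto
    also have "\<dots> \<le> v (Suc m)" using step by blast
    finally show ?case .
  qed simp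
  have "\<rho> \<le> q"
  proof (rule ccontr)
    assume "\<not> \<rho> \<le> q"
    then have gt: "q < \<rho>" by simp
    show False
    proof (cases "q = 0")
      case True
      then show False using bound[of 1] pos by simp
    next
      case False
      then have q0: "q > 0" using q by simp
      then have "1 < \<rho> / q" using gt by simp
      then obtain m where m: "C / v 0 < (\<rho> / q) ^ m" using real_arch_pow by blast
      have "v 0 * \<rho> ^ m \<le> C * q ^ m" using pw[of m] bound[of m] by linarith
      then have "(\<rho> / q) ^ m \<le> C / v 0" using pos q0
        by (simp add: field_simps power_divide)
      then show False using m by simp
    qed
  qed
  then show ?thesis using pos by (simp add: \<rho>_def field_simps)
qed

text \<open>Self-adjointness writes the squared norm of one iterate as the inner product of its two
  neighbours in the sequence, so by Cauchy-Schwarz the squared norms are log-convex. Only the rate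
  \<open>\<kappa>\<close> of the pointwise bound survives; \<open>C\<close> may be arbitrarily
  large.\<close>

lemma selfadjoint_contraction:
  fixes K :: "('a \<Rightarrow> real) \<Rightarrow> 'a \<Rightarrow> real"
  assumes "finite X"
    and sa: "\<And>f g. (\<Sum>x\<in>X. f x * K g x) = (\<Sum>x\<in>X. K f x * g x)"
    and bound: "\<And>m x. x \<in> X \<Longrightarrow> \<bar>(K ^^ m) f x\<bar> \<le> C * \<kappa> ^ m" and "0 \<le> \<kappa>"
  shows "(\<Sum>x\<in>X. (K f x)\<^sup>2) \<le> \<kappa>\<^sup>2 * (\<Sum>x\<in>X. (f x)\<^sup>2)"
proof -
  define v where "v m = (\<Sum>x\<in>X. ((K ^^ m) f x)\<^sup>2)" for m
  have "v 1 \<le> \<kappa>\<^sup>2 * v 0"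
  proof (rule log_convex_bound)
    show "0 \<le> v m" for m by (simp add: v_def sum_nonneg)
    show "(v (Suc m))\<^sup>2 \<le> v m * v (Suc (Suc m))" for m
    proof -
      have "v (Suc m) = (\<Sum>x\<in>X. (K ^^ m) f x * (K ^^ Suc (Suc m)) f x)"
        using sa[of "(K ^^ m) f" "(K ^^ Suc m) f"] by (simp add: v_def power2_eq_square)
      then show ?thesis unfolding v_def by (simp only: Cauchy_Schwarz_ineq_sum)
    qed
    show "v m \<le> (real (card X) * C\<^sup>2) * (\<kappa>\<^sup>2) ^ m" for m
    proof -
      have "v m \<le> (\<Sum>x\<in>X. (C * \<kappa> ^ m)\<^sup>2)" unfolding v_def
      proof (rule sum_mono)
        fix x assume "x \<in> X"
        then show "((K ^^ m) f x)\<^sup>2 \<le> (C * \<kappa> ^ m)\<^sup>2"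
          using bound[of x m] abs_ge_self[of "C * \<kappa> ^ m"] by (subst abs_le_square_iff[symmetric]) linarith
      qed
      also have "\<dots> = (real (card X) * C\<^sup>2) * (\<kappa>\<^sup>2) ^ m"
        by (simp add: power_mult_distrib power_mult[symmetric] mult.commute)
      finally show ?thesis .
    qed
  qed simp
  then show ?thesis by (simp add: v_def)
qed

section \<open>Averaging over disjoint sets: the normalised bipartite disjointness graph\<close>

definition disj_avg :: "'a set \<Rightarrow> nat \<Rightarrow> ('a set \<Rightarrow> real) \<Rightarrow> 'a set \<Rightarrow> real" where
  "disj_avg V a f z = (\<Sum>S\<in>nsets (V - z) a. f S) / real (card (V - z) choose a)"

text \<open>The Lipschitz condition on the Johnson graph: \<open>E\<close> is the common part of two
  neighbours, which differ by exchanging \<open>x\<close> for \<open>y\<close>.\<close>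

definition swap_lipschitz :: "'a set \<Rightarrow> nat \<Rightarrow> ('a set \<Rightarrow> real) \<Rightarrow> real \<Rightarrow> bool" where
  "swap_lipschitz V a f l \<longleftrightarrow> (\<forall>E x y. x \<notin> E \<and> y \<notin> E \<and> insert x E \<in> nsets V a \<and> insert y E \<in> nsets V a
     \<longrightarrow> \<bar>f (insert x E) - f (insert y E)\<bar> \<le> l)"

lemma nsets_diff: "nsets (V - z) a = {S \<in> nsets V a. S \<inter> z = {}}"
  by (auto simp: nsets_def)

lemma sum_nsets_insert:
  fixes f :: "'a set \<Rightarrow> real"
  assumes "finite W" "y \<notin> W"
  shows "(\<Sum>S\<in>nsets (insert y W) (Suc a). f S)
    = (\<Sum>S\<in>nsets W (Suc a). f S) + (\<Sum>R\<in>nsets W a. f (insert y R))"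
proof -
  have eq: "nsets (insert y W) (Suc a) = nsets W (Suc a) \<union> insert y ` nsets W a"
  proof
    show "nsets (insert y W) (Suc a) \<subseteq> nsets W (Suc a) \<union> insert y ` nsets W a"
    proof
      fix S assume S: "S \<in> nsets (insert y W) (Suc a)"
      show "S \<in> nsets W (Suc a) \<union> insert y ` nsets W a"
      proof (cases "y \<in> S")
        case True
        then have "S = insert y (S - {y})" "S - {y} \<in> nsets W a"
          using S by (auto simp: nsets_def)
        then show ?thesis by blast
      qed (use S in \<open>auto simp: nsets_def\<close>)
    qed
    show "nsets W (Suc a) \<union> insert y ` nsets W a \<subseteq> nsets (insert y W) (Suc a)"
      using assms by (auto simp: nsets_def card_insert_if)
  qed
  have inj: "inj_on (insert y) (nsets W a)"
  proof (rule inj_onI)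
    fix P Q assume "P \<in> nsets W a" "Q \<in> nsets W a" "insert y P = insert y Q"
    then show "P = Q" using assms insert_ident[of y P Q] by (auto simp: nsets_def)
  qed
  show ?thesis unfolding eq
    by (subst sum.union_disjoint)
      (use assms inj in \<open>auto simp: finite_imp_finite_nsets sum.reindex nsets_def\<close>)
qed

lemma swap_lipschitz_dist:
  assumes "swap_lipschitz V a f l" "S \<in> nsets V a" "S' \<in> nsets V a"
  shows "\<bar>f S - f S'\<bar> \<le> real (card (S - S')) * l"
  using assms(2)
proof (induction "card (S - S')" arbitrary: S)
  case 0
  have fin: "finite S" "finite S'" "card S = card S'" using 0 assms by (auto simp: nsets_def)
  then have "S \<subseteq> S'" using 0 by auto
  then have "S = S'" using fin by (simp add: card_subset_eq)
  then show ?case by simp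
next
  case (Suc d)
  have fin: "finite S" "finite S'" "card S = card S'" using Suc assms by (auto simp: nsets_def)
  then obtain x where x: "x \<in> S" "x \<notin> S'" using Suc(2) by (metis DiffE card.empty ex_in_conv nat.distinct(1))
  have "\<not> S' \<subseteq> S" using x fin by (metis card_subset_eq)
  then obtain y where y: "y \<in> S'" "y \<notin> S" by blast
  define R where "R = insert y (S - {x})"
  have R: "R \<in> nsets V a"
  proof -
    have "card R = card S" using x y fin card_Suc_Diff1[of S x] by (simp add: R_def card_insert_if)
    then show ?thesis using Suc(3) assms(3) y by (auto simp: R_def nsets_def)
  qed
  have "R - S' = (S - S') - {x}" using y by (auto simp: R_def)
  then have "d = card (R - S')" using Suc(2) x fin by simp
  from Suc(1)[OF this R] have 1: "\<bar>f R - f S'\<bar> \<le> real (card (R - S')) * l" .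
  have Sx: "insert x (S - {x}) = S" using x by auto
  have "\<bar>f (insert x (S - {x})) - f (insert y (S - {x}))\<bar> \<le> l"
    using assms(1) R Suc(3) y unfolding swap_lipschitz_def R_def
    by (metis Diff_iff Sx singletonI)
  then have 2: "\<bar>f S - f R\<bar> \<le> l" by (simp only: Sx R_def)
  have "real (card (S - S')) * l = l + real d * l"
    using Suc(2) by (simp add: algebra_simps flip: Suc(2))
  moreover have "\<bar>f R - f S'\<bar> \<le> real d * l" using 1 \<open>d = card (R - S')\<close> by simp
  ultimately show ?case using 2 by linarith
qed

text \<open>Any two \<open>a\<close>-sets are at most \<open>a\<close> exchanges apart, and a
  function of mean zero is the average of its differences to all other values. This converts
  Lipschitz constants into the pointwise bounds that \<open>selfadjoint_contraction\<close> asks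
  for.\<close>

lemma swap_lipschitz_mean_zero:
  assumes "finite V" "a \<le> card V" "swap_lipschitz V a f l" "0 \<le> l" "(\<Sum>S\<in>nsets V a. f S) = 0"
    and S: "S \<in> nsets V a"
  shows "\<bar>f S\<bar> \<le> real a * l"
proof -
  have c: "card (nsets V a) > 0" using assms by (simp add: card_nsets)
  have "real (card (nsets V a)) * f S = (\<Sum>S'\<in>nsets V a. f S - f S')"
    using assms by (simp add: sum_subtractf)
  also have "\<bar>\<dots>\<bar> \<le> (\<Sum>S'\<in>nsets V a. \<bar>f S - f S'\<bar>)" by (rule sum_abs)
  also have "\<dots> \<le> (\<Sum>S'\<in>nsets V a. real a * l)"
  proof (rule sum_mono)
    fix S' assume S': "S' \<in> nsets V a"
    have "card (S - S') \<le> a" using S card_mono[of S "S - S'"] by (auto simp: nsets_def)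
    then show "\<bar>f S - f S'\<bar> \<le> real a * l"
      using swap_lipschitz_dist[OF assms(3) S S'] \<open>0 \<le> l\<close>
      by (meson mult_right_mono of_nat_le_iff order_trans)
  qed
  finally have "real (card (nsets V a)) * \<bar>f S\<bar> \<le> real (card (nsets V a)) * (real a * l)"
    by (simp add: abs_mult)
  then show ?thesis using c by (metis mult_le_cancel_left_pos of_nat_0_less_iff)
qed

text \<open>Path coupling: uniform \<open>a\<close>-sets avoiding \<open>E \<union> {x}\<close> and \<open>E \<union> {y}\<close> can be coupled so that they agree
  unless the first contains \<open>y\<close>, which has probability \<open>a / (N - b)\<close>.\<close>

lemma swap_lipschitz_disj_avg:
  assumes V: "finite V" and ab: "a + b \<le> card V" "b < card V" and f: "swap_lipschitz V a f l" and l: "0 \<le> l"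
  shows "swap_lipschitz V b (disj_avg V a f) (real a / real (card V - b) * l)"
  unfolding swap_lipschitz_def
proof (intro allI impI, elim conjE)
  fix E x y
  assume xy: "x \<notin> E" "y \<notin> E" "insert x E \<in> nsets V b" "insert y E \<in> nsets V b"
  show "\<bar>disj_avg V a f (insert x E) - disj_avg V a f (insert y E)\<bar> \<le> real a / real (card V - b) * l"
  proof (cases "x = y \<or> a = 0")
    case True
    then show ?thesis using l by (auto simp: disj_avg_def)
  next
    case False
    then obtain a' where a: "a = Suc a'" by (cases a) auto
    define W where "W = V - insert x (insert y E)"
    have W: "finite W" "x \<notin> W" "y \<notin> W" using V by (auto simp: W_def)
    have Vx: "V - insert x E = insert y W" and Vy: "V - insert y E = insert x W"
      using xy False by (auto simp: W_def nsets_def)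
    have "card (V - insert x E) = card V - b" "card (V - insert y E) = card V - b"
      using xy V by (auto simp: nsets_def card_Diff_subset)
    then have c: "card (insert y W) = card V - b" "card (insert x W) = card V - b"
      by (simp_all add: Vx Vy)
    then have cW: "card V - b = Suc (card W)" using W by simp
    \<comment> \<open>The sets avoiding both \<open>x\<close> and \<open>y\<close> occur in both
      averages and cancel; the rest pairs \<open>insert y R\<close> with
      \<open>insert x R\<close>.\<close>
    have "disj_avg V a f (insert x E) - disj_avg V a f (insert y E)
        = ((\<Sum>R\<in>nsets W a'. f (insert y R)) - (\<Sum>R\<in>nsets W a'. f (insert x R))) / real (Suc (card W) choose a)"
      unfolding disj_avg_def Vx Vy c cW
      using W by (simp add: a sum_nsets_insert diff_divide_distrib add_divide_distrib)
    also have "\<dots> = (\<Sum>R\<in>nsets W a'. f (insert y R) - f (insert x R)) / real (Suc (card W) choose a)"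
      by (simp add: sum_subtractf)
    finally have eq: "disj_avg V a f (insert x E) - disj_avg V a f (insert y E) = \<dots>" .
    have "\<bar>\<Sum>R\<in>nsets W a'. f (insert y R) - f (insert x R)\<bar> \<le> (\<Sum>R\<in>nsets W a'. l)"
    proof (rule order_trans[OF sum_abs], rule sum_mono)
      fix R assume R: "R \<in> nsets W a'"
      have "x \<in> V" "y \<in> V" using xy by (auto simp: nsets_def)
      then have "x \<notin> R" "y \<notin> R" "insert y R \<in> nsets V a" "insert x R \<in> nsets V a"
        using R W by (auto simp: nsets_def a W_def card_insert_if)
      then show "\<bar>f (insert y R) - f (insert x R)\<bar> \<le> l"
        using f unfolding swap_lipschitz_def by blast
    qed
    also have "\<dots> = real (card W choose a') * l" using W by (simp add: card_nsets)
    finally have 1: "\<bar>\<Sum>R\<in>nsets W a'. f (insert y R) - f (insert x R)\<bar> \<le> real (card W choose a') * l" .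
    have "a' \<le> card W" using ab a cW by linarith
    then have pos: "0 < real (Suc (card W) choose a)"
      unfolding of_nat_0_less_iff a by (intro zero_less_binomial) simp
    have "real (Suc (card W) choose a) * real a = real (Suc (card W)) * real (card W choose a')"
      using Suc_times_binomial_eq[of "card W" a'] unfolding a by (metis of_nat_mult mult.commute)
    then have 2: "real (card W choose a') / real (Suc (card W) choose a) = real a / real (Suc (card W))"
      using pos by (simp add: field_simps)
    have "\<bar>disj_avg V a f (insert x E) - disj_avg V a f (insert y E)\<bar>
       \<le> real (card W choose a') * l / real (Suc (card W) choose a)"
      unfolding eq abs_divide using 1 pos by (simp add: divide_right_mono)
    also have "\<dots> = real a / real (card V - b) * l" unfolding cW using 2 by (metis times_divide_eq_left)
    finally show ?thesis .
  qed
qed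

text \<open>Both sides are the sum of \<open>g z * f S\<close> over all disjoint pairs; the binomial
  factors are the degrees by which the two averages were divided.\<close>

lemma disj_avg_adjoint:
  assumes V: "finite V" and ab: "a + b \<le> card V"
  shows "(\<Sum>z\<in>nsets V b. g z * disj_avg V a f z) * real (card V - b choose a)
       = (\<Sum>S\<in>nsets V a. f S * disj_avg V b g S) * real (card V - a choose b)"
proof -
  have 1: "(\<Sum>z\<in>nsets V b. g z * disj_avg V a f z) * real (card V - b choose a)
     = (\<Sum>z\<in>nsets V b. \<Sum>S\<in>{S\<in>nsets V a. S \<inter> z = {}}. g z * f S)" if "a + b \<le> card V" for a b and f g :: "'a set \<Rightarrow> real"
    unfolding sum_distrib_right
  proof (rule sum.cong)
    fix z assume z: "z \<in> nsets V b"
    then have "card (V - z) = card V - b" by (auto simp: nsets_def card_Diff_subset)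
    moreover have "card V - b choose a > 0" using that by simp
    ultimately show "g z * disj_avg V a f z * real (card V - b choose a) = (\<Sum>S\<in>{S\<in>nsets V a. S \<inter> z = {}}. g z * f S)"
      by (simp add: disj_avg_def nsets_diff sum_distrib_left)
  qed simp
  have "(\<Sum>z\<in>nsets V b. \<Sum>S\<in>{S\<in>nsets V a. S \<inter> z = {}}. g z * f S)
     = (\<Sum>S\<in>nsets V a. \<Sum>z\<in>{z\<in>nsets V b. S \<inter> z = {}}. g z * f S)"
    by (rule sum.swap_restrict) (use V in \<open>auto simp: finite_imp_finite_nsets\<close>)
  then show ?thesis using 1[OF ab] 1[of b a f g] ab by (simp add: Int_commute mult.commute add.commute)
qed

lemma disj_avg_const:
  assumes V: "finite V" and ab: "a + b \<le> card V" and z: "z \<in> nsets V b"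
  shows "disj_avg V a (\<lambda>_. c) z = c"
proof -
  have "card (V - z) = card V - b" using V z by (auto simp: nsets_def card_Diff_subset)
  moreover have "card V - b choose a > 0" using ab by simp
  ultimately show ?thesis using V by (simp add: disj_avg_def card_nsets)
qed

lemma disj_avg_sum:
  assumes V: "finite V" and ab: "a + b \<le> card V"
  shows "(\<Sum>z\<in>nsets V b. disj_avg V a f z) * real (card V - b choose a)
       = (\<Sum>S\<in>nsets V a. f S) * real (card V - a choose b)"
  using disj_avg_adjoint[OF V ab, of "\<lambda>_. 1" f] disj_avg_const[OF V, of b a _ 1] ab
  by (simp add: add.commute)

text \<open>Choosing either of two disjoint sets first amounts to choosing their union and then
  splitting it.\<close>

lemma card_disjoint_pairs:
  assumes "a + b \<le> N"
  shows "real (N choose b) * real (N - b choose a) = real (N choose a) * real (N - a choose b)"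
proof -
  have "(N choose (a + b)) * ((a + b) choose a) = (N choose a) * ((N - a) choose b)"
    using choose_mult[of a "a + b" N] assms by simp
  moreover have "(N choose (a + b)) * ((a + b) choose b) = (N choose b) * ((N - b) choose a)"
    using choose_mult[of b "a + b" N] assms by simp
  moreover have "(a + b) choose a = (a + b) choose b"
    using binomial_symmetric[of a "a + b"] by simp
  ultimately show ?thesis by (metis of_nat_mult)
qed

text \<open>The Lipschitz contraction of the self-adjoint operator \<open>K\<close> (averaging to \<open>b\<close>-sets and back) bounds
  \<open>\<parallel>K\<^sup>m f\<parallel>\<close> for large \<open>m\<close>; log-convexity in \<open>m\<close> transfers the rate to \<open>m = 1\<close> without eigenvalues.\<close>

lemma disj_avg_contraction:
  assumes V: "finite V" and ab: "a + b \<le> card V" "a < card V" "b < card V"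
    and mean: "(\<Sum>S\<in>nsets V a. f S) = 0"
  shows "(\<Sum>z\<in>nsets V b. (disj_avg V a f z)\<^sup>2) / real (card V choose b)
     \<le> (real a * real b / (real (card V - a) * real (card V - b))) *
        ((\<Sum>S\<in>nsets V a. (f S)\<^sup>2) / real (card V choose a))"
proof -
  define \<kappa> where "\<kappa> = real a * real b / (real (card V - a) * real (card V - b))"
  define ca where "ca = real (card V - b choose a)"
  define cb where "cb = real (card V - a choose b)"
  have c: "ca > 0" "cb > 0" using ab by (auto simp: ca_def cb_def)
  have ba: "b + a \<le> card V" using ab by simp
  have \<kappa>: "0 \<le> \<kappa>" by (simp add: \<kappa>_def)
  define K where "K = (\<lambda>f. disj_avg V b (disj_avg V a f))"
  have dual: "(\<Sum>S\<in>nsets V a. f S * K g S) = (\<Sum>z\<in>nsets V b. disj_avg V a f z * disj_avg V a g z) * (ca / cb)" for f g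
    using disj_avg_adjoint[OF V ab(1), of "disj_avg V a g" f] c unfolding K_def ca_def[symmetric] cb_def[symmetric]
    by (simp add: field_simps)
  have Ksum: "(\<Sum>S\<in>nsets V a. K g S) = (\<Sum>S\<in>nsets V a. g S)" for g
    using disj_avg_sum[OF V ab(1), of g] disj_avg_sum[OF V ba, of "disj_avg V a g"] c
    unfolding K_def ca_def[symmetric] cb_def[symmetric] by simp
  \<comment> \<open>Any Lipschitz constant will do: it enters only the factor \<open>C\<close> of
    \<open>selfadjoint_contraction\<close>, which drops out.\<close>
  define l where "l = (\<Sum>S\<in>nsets V a. \<bar>f S\<bar>) * 2"
  have l: "0 \<le> l" by (simp add: l_def sum_nonneg)
  have lip: "swap_lipschitz V a f l" unfolding swap_lipschitz_def
  proof (intro allI impI, elim conjE)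
    fix E x y assume "insert x E \<in> nsets V a" "insert y E \<in> nsets V a"
    then have "\<bar>f (insert x E)\<bar> \<le> (\<Sum>S\<in>nsets V a. \<bar>f S\<bar>)" "\<bar>f (insert y E)\<bar> \<le> (\<Sum>S\<in>nsets V a. \<bar>f S\<bar>)"
      using V by (auto intro!: member_le_sum simp: finite_imp_finite_nsets)
    then show "\<bar>f (insert x E) - f (insert y E)\<bar> \<le> l" unfolding l_def by linarith
  qed
  have Kpow: "swap_lipschitz V a ((K ^^ m) f) (\<kappa> ^ m * l) \<and> (\<Sum>S\<in>nsets V a. (K ^^ m) f S) = 0" for m
  proof (induction m)
    case 0
    then show ?case using lip mean by simp
  next
    case (Suc m)
    have nn: "0 \<le> \<kappa> ^ m * l" using \<kappa> l by simp
    have "swap_lipschitz V b (disj_avg V a ((K ^^ m) f)) (real a / real (card V - b) * (\<kappa> ^ m * l))"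
      using swap_lipschitz_disj_avg[OF V ab(1) ab(3) _ nn] Suc by blast
    then have "swap_lipschitz V a (K ((K ^^ m) f)) (real b / real (card V - a) * (real a / real (card V - b) * (\<kappa> ^ m * l)))"
      unfolding K_def by (rule swap_lipschitz_disj_avg[OF V ba ab(2)]) (use nn in simp)
    moreover have "real b / real (card V - a) * (real a / real (card V - b) * (\<kappa> ^ m * l)) = \<kappa> ^ Suc m * l"
      by (simp add: \<kappa>_def)
    ultimately show ?case using Suc Ksum by simp
  qed
  have "(\<Sum>S\<in>nsets V a. (K f S)\<^sup>2) \<le> \<kappa>\<^sup>2 * (\<Sum>S\<in>nsets V a. (f S)\<^sup>2)"
  proof (rule selfadjoint_contraction[where C = "real a * l"])
    show "finite (nsets V a)" using V by (rule finite_imp_finite_nsets)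
    show "(\<Sum>x\<in>nsets V a. f x * K g x) = (\<Sum>x\<in>nsets V a. K f x * g x)" for f g
      using dual[of f g] dual[of g f] by (simp add: mult.commute)
    show "\<bar>(K ^^ m) f x\<bar> \<le> real a * l * \<kappa> ^ m" if "x \<in> nsets V a" for m x
      using swap_lipschitz_mean_zero[OF V _ _ _ _ that, of "(K ^^ m) f" "\<kappa> ^ m * l"] Kpow[of m] \<kappa> l ab
      by (simp add: mult_ac)
  qed (rule \<kappa>)
  \<comment> \<open>The contraction of \<open>K\<close> bounds the inner product of \<open>f\<close>
    and \<open>K f\<close> by \<open>\<kappa>\<close> times the squared norm of \<open>f\<close>. By
    \<open>dual\<close> that inner product is, up to normalisation, the squared norm of
    \<open>disj_avg V a f\<close>, so one averaging step contracts by the square root of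
    \<open>\<kappa>\<close>.\<close>
  then have "(\<Sum>S\<in>nsets V a. f S * K f S)\<^sup>2 \<le> (\<Sum>S\<in>nsets V a. (f S)\<^sup>2) * (\<kappa>\<^sup>2 * (\<Sum>S\<in>nsets V a. (f S)\<^sup>2))"
    by (intro order_trans[OF Cauchy_Schwarz_ineq_sum] mult_left_mono) (auto intro: sum_nonneg)
  also have "\<dots> = (\<kappa> * (\<Sum>S\<in>nsets V a. (f S)\<^sup>2))\<^sup>2" by (simp add: power2_eq_square)
  finally have "(\<Sum>S\<in>nsets V a. f S * K f S) \<le> \<kappa> * (\<Sum>S\<in>nsets V a. (f S)\<^sup>2)"
    by (rule power2_le_imp_le) (use \<kappa> in \<open>auto intro!: mult_nonneg_nonneg sum_nonneg\<close>)
  then have 1: "(\<Sum>z\<in>nsets V b. (disj_avg V a f z)\<^sup>2) * (ca / cb) \<le> \<kappa> * (\<Sum>S\<in>nsets V a. (f S)\<^sup>2)"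
    by (simp add: dual power2_eq_square)
  have 2: "real (card V choose b) * ca = real (card V choose a) * cb"
    unfolding ca_def cb_def by (rule card_disjoint_pairs[OF ab(1)])
  have pa: "real (card V choose a) > 0" "real (card V choose b) > 0" using ab by auto
  have "ca / cb = real (card V choose a) / real (card V choose b)"
    using 2 pa c by (simp add: field_simps)
  then show ?thesis using 1 pa unfolding \<kappa>_def[symmetric] by (simp add: field_simps)
qed

section \<open>Densities and the mixing inequality\<close>

definition set_density :: "'a set \<Rightarrow> nat \<Rightarrow> 'a set set \<Rightarrow> real" where
  "set_density V a F = real (card F) / real (card V choose a)"

lemma set_density_nonneg: "0 \<le> set_density V a F"
  by (simp add: set_density_def)

lemma set_density_le_1:
  assumes "finite V" "F \<subseteq> nsets V a"
  shows "set_density V a F \<le> 1"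
proof -
  have "card F \<le> card V choose a" using assms card_mono[OF finite_imp_finite_nsets] by (metis card_nsets)
  then show ?thesis by (simp add: set_density_def divide_le_eq)
qed

text \<open>An expander mixing lemma: after centring both indicators, Cauchy-Schwarz and
  \<open>disj_avg_contraction\<close> leave the product of their variances. The factors
  \<open>1 - set_density V a F\<close> and \<open>1 - set_density V b G\<close> are kept because
  \<open>upshadow_expansion\<close> and \<open>link_dichotomy\<close> deal with densities far from
  0.\<close>

lemma disjointness_mixing:
  assumes V: "finite V" and ab: "a + b \<le> card V" "a < card V" "b < card V"
    and F: "F \<subseteq> nsets V a" and G: "G \<subseteq> nsets V b"
  shows "(real (card {(S, z). S \<in> F \<and> z \<in> G \<and> S \<inter> z = {}})
            / (real (card V choose b) * real (card V - b choose a))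
            - set_density V a F * set_density V b G)\<^sup>2
      \<le> (real a * real b / (real (card V - a) * real (card V - b)))
        * (set_density V a F * (1 - set_density V a F)) * (set_density V b G * (1 - set_density V b G))"
proof -
  define \<phi> where "\<phi> = set_density V a F"
  define \<psi> where "\<psi> = set_density V b G"
  define P where "P = real (card {(S, z). S \<in> F \<and> z \<in> G \<and> S \<inter> z = {}})
            / (real (card V choose b) * real (card V - b choose a))"
  define X where "X = nsets V a"
  define Z where "Z = nsets V b"
  define \<kappa> where "\<kappa> = real a * real b / (real (card V - a) * real (card V - b))"
  define A where "A = real (card V choose a)"
  define B where "B = real (card V choose b)"
  define ca where "ca = real (card V - b choose a)"
  have pos: "A > 0" "B > 0" "ca > 0" using ab by (auto simp: A_def B_def ca_def)
  have fin: "finite X" "finite Z" "finite F" "finite G"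
    using finite_imp_finite_nsets[OF V] finite_subset[OF F] finite_subset[OF G] by (auto simp: X_def Z_def)
  have cX: "real (card X) = A" "real (card Z) = B" using V by (auto simp: X_def Z_def A_def B_def card_nsets)
  define f where "f S = of_bool (S \<in> F) - \<phi>" for S
  define g where "g z = of_bool (z \<in> G) - \<psi>" for z
  have ind: "(\<Sum>S\<in>X. of_bool (S \<in> F)) = \<phi> * A" "(\<Sum>z\<in>Z. of_bool (z \<in> G)) = \<psi> * B"
  proof -
    have "X \<inter> {S. S \<in> F} = F" "Z \<inter> {S. S \<in> G} = G" using F G by (auto simp: X_def Z_def)
    then show "(\<Sum>S\<in>X. of_bool (S \<in> F)) = \<phi> * A" "(\<Sum>z\<in>Z. of_bool (z \<in> G)) = \<psi> * B"
      using fin pos by (simp_all add: \<phi>_def \<psi>_def set_density_def A_def B_def)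
  qed
  have sf: "(\<Sum>S\<in>X. f S) = 0" and sg: "(\<Sum>z\<in>Z. g z) = 0"
    by (auto simp: f_def g_def sum_subtractf ind cX)
  have sq: "(\<Sum>S\<in>Y. (of_bool (P S) - c)\<^sup>2) = (1 - 2 * c) * (\<Sum>S\<in>Y. of_bool (P S)) + c\<^sup>2 * real (card Y)"
    for Y :: "'a set set" and P c
  proof -
    have "(\<Sum>S\<in>Y. (of_bool (P S) - c)\<^sup>2) = (\<Sum>S\<in>Y. (1 - 2 * c) * of_bool (P S) + c\<^sup>2)"
      by (rule sum.cong) (auto simp: power2_eq_square algebra_simps)
    then show ?thesis by (simp add: sum.distrib sum_distrib_left)
  qed
  have sf2: "(\<Sum>S\<in>X. (f S)\<^sup>2) = \<phi> * (1 - \<phi>) * A" and sg2: "(\<Sum>z\<in>Z. (g z)\<^sup>2) = \<psi> * (1 - \<psi>) * B"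
    unfolding f_def g_def sq ind cX by (auto simp: algebra_simps power2_eq_square)
  let ?U = "disj_avg V a"
  have Uf: "?U f z = real (card {S \<in> F. S \<inter> z = {}}) / ca - \<phi>" if "z \<in> Z" for z
  proof -
    have c: "card (V - z) = card V - b" using V that by (auto simp: Z_def nsets_def card_Diff_subset)
    have "(\<Sum>S\<in>nsets (V - z) a. f S) = (\<Sum>S\<in>nsets (V - z) a. of_bool (S \<in> F)) - \<phi> * ca"
      using V c by (simp add: f_def sum_subtractf card_nsets ca_def)
    also have "(\<Sum>S\<in>nsets (V - z) a. of_bool (S \<in> F)) = real (card {S \<in> F. S \<inter> z = {}})"
    proof -
      have "nsets (V - z) a \<inter> {S. S \<in> F} = {S \<in> F. S \<inter> z = {}}" using F by (auto simp: nsets_diff)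
      then show ?thesis using V by (simp add: finite_imp_finite_nsets)
    qed
    finally show ?thesis using pos by (simp add: disj_avg_def c ca_def[symmetric] diff_divide_distrib)
  qed
  have pairs: "{(S, z). S \<in> F \<and> z \<in> G \<and> S \<inter> z = {}} = (\<lambda>(z, S). (S, z)) ` (SIGMA z:G. {S \<in> F. S \<inter> z = {}})"
    by auto
  have "card {(S, z). S \<in> F \<and> z \<in> G \<and> S \<inter> z = {}} = card (SIGMA z:G. {S \<in> F. S \<inter> z = {}})"
    unfolding pairs by (rule card_image) (auto simp: inj_on_def)
  also have "\<dots> = (\<Sum>z\<in>G. card {S \<in> F. S \<inter> z = {}})" using fin by simp
  finally have Psum: "P = (\<Sum>z\<in>G. real (card {S \<in> F. S \<inter> z = {}})) / (B * ca)"
    by (simp add: P_def B_def ca_def)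
  have sU: "(\<Sum>z\<in>Z. ?U f z) = 0"
    using disj_avg_sum[OF V ab(1), of f] sf pos by (simp add: X_def Z_def ca_def)
  have "(\<Sum>z\<in>Z. g z * ?U f z) = (\<Sum>z\<in>Z. of_bool (z \<in> G) * ?U f z)"
    using sU by (simp add: g_def left_diff_distrib sum_subtractf flip: sum_distrib_left)
  also have "\<dots> = (\<Sum>z\<in>G. ?U f z)"
    using G fin by (intro sum.mono_neutral_cong_right) (auto simp: Z_def)
  also have "\<dots> = (\<Sum>z\<in>G. real (card {S \<in> F. S \<inter> z = {}}) / ca - \<phi>)"
    using G by (intro sum.cong Uf) (auto simp: Z_def)
  also have "\<dots> = B * (P - \<phi> * \<psi>)"
    using pos by (simp add: sum_subtractf Psum \<psi>_def set_density_def sum_divide_distrib[symmetric] B_def[symmetric] field_simps)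
  finally have "(B * (P - \<phi> * \<psi>))\<^sup>2 \<le> (\<Sum>z\<in>Z. (g z)\<^sup>2) * (\<Sum>z\<in>Z. (?U f z)\<^sup>2)"
    using Cauchy_Schwarz_ineq_sum[of g "?U f" Z] by simp
  also have "\<dots> \<le> (\<Sum>z\<in>Z. (g z)\<^sup>2) * (\<kappa> * (\<phi> * (1 - \<phi>)) * B)"
  proof (rule mult_left_mono)
    have "(\<Sum>z\<in>Z. (?U f z)\<^sup>2) / B \<le> \<kappa> * ((\<Sum>S\<in>X. (f S)\<^sup>2) / A)"
      unfolding \<kappa>_def A_def B_def X_def Z_def
      by (rule disj_avg_contraction[OF V ab]) (use sf in \<open>simp add: X_def\<close>)
    then show "(\<Sum>z\<in>Z. (?U f z)\<^sup>2) \<le> \<kappa> * (\<phi> * (1 - \<phi>)) * B"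
      using pos by (simp add: sf2 divide_le_eq)
  qed (auto intro: sum_nonneg)
  also have "\<dots> = B\<^sup>2 * (\<kappa> * (\<phi> * (1 - \<phi>)) * (\<psi> * (1 - \<psi>)))"
    unfolding sg2 by (simp add: power2_eq_square mult_ac)
  finally have "B\<^sup>2 * (P - \<phi> * \<psi>)\<^sup>2 \<le> B\<^sup>2 * (\<kappa> * (\<phi> * (1 - \<phi>)) * (\<psi> * (1 - \<psi>)))"
    by (simp add: power_mult_distrib)
  then show ?thesis using pos unfolding \<kappa>_def[symmetric] \<phi>_def[symmetric] \<psi>_def[symmetric] P_def[symmetric] by simp
qed

section \<open>Averages over permutations\<close>

text \<open>Random disjoint sets are modelled as images of fixed disjoint blocks under a uniformly
  random permutation, so any number of blocks can be treated at once.\<close>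

definition perm_avg :: "'a set \<Rightarrow> (('a \<Rightarrow> 'a) \<Rightarrow> real) \<Rightarrow> real" where
  "perm_avg V h = (\<Sum>\<pi> | \<pi> permutes V. h \<pi>) / fact (card V)"

lemma perm_avg_mono:
  assumes "\<And>\<pi>. \<pi> permutes V \<Longrightarrow> h \<pi> \<le> h' \<pi>"
  shows "perm_avg V h \<le> perm_avg V h'"
  unfolding perm_avg_def by (intro divide_right_mono sum_mono) (use assms in auto)

lemma perm_avg_sum: "perm_avg V (\<lambda>\<pi>. \<Sum>i\<in>I. h i \<pi>) = (\<Sum>i\<in>I. perm_avg V (h i))"
  unfolding perm_avg_def by (subst sum.swap) (simp add: sum_divide_distrib)

lemma perm_avg_mult: "perm_avg V (\<lambda>\<pi>. c * h \<pi>) = c * perm_avg V h"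
  by (simp add: perm_avg_def sum_distrib_left)

lemma perm_avg_const: "finite V \<Longrightarrow> perm_avg V (\<lambda>_. c) = c"
  by (simp add: perm_avg_def card_permutations)

lemma ex_permutation_image:
  assumes V: "finite V" and sub: "A \<subseteq> V" "B \<subseteq> V" "S \<subseteq> V" "z \<subseteq> V"
    and disj: "A \<inter> B = {}" "S \<inter> z = {}" and c: "card A = card S" "card B = card z"
  obtains \<sigma> where "\<sigma> permutes V" "\<sigma> ` A = S" "\<sigma> ` B = z"
proof -
  have fin: "finite A" "finite B" "finite S" "finite z" using sub V finite_subset by blast+
  obtain f where f: "bij_betw f A S" using finite_same_card_bij[OF fin(1,3) c(1)] by blast
  obtain g where g: "bij_betw g B z" using finite_same_card_bij[OF fin(2,4) c(2)] by blast
  have "card (V - (A \<union> B)) = card (V - (S \<union> z))"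
    using sub V fin disj c by (simp add: card_Diff_subset card_Un_disjoint)
  then obtain h where h: "bij_betw h (V - (A \<union> B)) (V - (S \<union> z))"
    using finite_same_card_bij V by (metis finite_Diff)
  define \<sigma> where "\<sigma> x = (if x \<in> A then f x else if x \<in> B then g x else if x \<in> V then h x else x)" for x
  have A: "bij_betw \<sigma> A S" using f by (subst bij_betw_cong[of _ _ f]) (auto simp: \<sigma>_def)
  have B: "bij_betw \<sigma> B z" using g disj by (subst bij_betw_cong[of _ _ g]) (auto simp: \<sigma>_def)
  have C: "bij_betw \<sigma> (V - (A \<union> B)) (V - (S \<union> z))"
    using h by (subst bij_betw_cong[of _ _ h]) (auto simp: \<sigma>_def)
  have "bij_betw \<sigma> ((A \<union> B) \<union> (V - (A \<union> B))) ((S \<union> z) \<union> (V - (S \<union> z)))"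
    by (intro bij_betw_combine A B C) (use disj in auto)
  moreover have "(A \<union> B) \<union> (V - (A \<union> B)) = V" "(S \<union> z) \<union> (V - (S \<union> z)) = V" using sub by auto
  ultimately have "bij_betw \<sigma> V V" by simp
  then have "\<sigma> permutes V" by (rule bij_imp_permutes) (use sub in \<open>auto simp: \<sigma>_def\<close>)
  then show ?thesis using that A B by (auto simp: bij_betw_def)
qed

text \<open>Composition with a permutation taking \<open>(A, B)\<close> to \<open>(S, z)\<close> is
  a bijection between the fibres over these two pairs. Hence the image pair is uniform on the
  disjoint pairs of the given sizes.\<close>

lemma perm_avg_image_pair:
  assumes V: "finite V" and sub: "A \<subseteq> V" "B \<subseteq> V" and disj: "A \<inter> B = {}"
  shows "perm_avg V (\<lambda>\<pi>. f (\<pi> ` A) (\<pi> ` B))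
     = (\<Sum>p\<in>{(S, z). S \<in> nsets V (card A) \<and> z \<in> nsets V (card B) \<and> S \<inter> z = {}}. f (fst p) (snd p)) /
       (real (card V choose card B) * real (card V - card B choose card A))"
proof -
  define a where "a = card A"
  define b where "b = card B"
  define pairs where "pairs = {(S, z). S \<in> nsets V a \<and> z \<in> nsets V b \<and> S \<inter> z = {}}"
  have pairs': "pairs = (\<lambda>(z, S). (S, z)) ` (SIGMA z:nsets V b. nsets (V - z) a)"
    by (auto simp: pairs_def nsets_diff)
  have "card pairs = card (SIGMA z:nsets V b. nsets (V - z) a)"
    unfolding pairs' by (rule card_image) (auto simp: inj_on_def)
  also have "\<dots> = (\<Sum>z\<in>nsets V b. card (nsets (V - z) a))"
    using V by (simp add: finite_imp_finite_nsets)
  also have "\<dots> = (\<Sum>z\<in>nsets V b. card V - b choose a)"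
  proof (rule sum.cong)
    fix z assume "z \<in> nsets V b"
    then have "card (V - z) = card V - b" using V by (auto simp: nsets_def card_Diff_subset)
    then show "card (nsets (V - z) a) = card V - b choose a" using V by (simp add: card_nsets)
  qed simp
  finally have cp: "card pairs = (card V choose b) * (card V - b choose a)"
    using V by (simp add: card_nsets)
  have finp: "finite pairs" unfolding pairs' using V by (simp add: finite_imp_finite_nsets)
  define PV where "PV = {\<pi>. \<pi> permutes V}"
  define q where "q \<pi> = (\<pi> ` A, \<pi> ` B)" for \<pi> :: "'a \<Rightarrow> 'a"
  have finPV: "finite PV" using V by (simp add: PV_def finite_permutations)
  have qimg: "q ` PV \<subseteq> pairs"
  proof (clarsimp simp: q_def PV_def pairs_def)
    fix \<pi> assume p: "\<pi> permutes V"
    then have inj: "inj \<pi>" by (rule permutes_inj)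
    then have c: "card (\<pi> ` Y) = card Y" for Y by (intro card_image) (auto intro: inj_on_subset)
    have im: "\<pi> ` Y \<in> nsets V (card Y)" if "Y \<subseteq> V" for Y
      using that p V c[of Y] finite_subset[OF that V] permutes_in_image[OF p] by (auto simp: nsets_def)
    show "\<pi> ` A \<in> nsets V a \<and> \<pi> ` B \<in> nsets V b \<and> \<pi> ` A \<inter> \<pi> ` B = {}"
      using im sub disj image_Int[OF inj, of A B] by (auto simp: a_def b_def)
  qed
  define c where "c = card {\<pi> \<in> PV. q \<pi> = (A, B)}"
  have fiber: "card {\<pi> \<in> PV. q \<pi> = p} = c" if "p \<in> pairs" for p
  proof -
    obtain S z where p: "p = (S, z)" by (cases p)
    then have Sz: "S \<subseteq> V" "z \<subseteq> V" "card S = a" "card z = b" "S \<inter> z = {}"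
      using that by (auto simp: pairs_def nsets_def)
    obtain \<sigma> where \<sigma>: "\<sigma> permutes V" "\<sigma> ` A = S" "\<sigma> ` B = z"
      using ex_permutation_image[OF V sub Sz(1,2) disj Sz(5)] Sz by (metis a_def b_def)
    have inj: "inj \<sigma>" using \<sigma>(1) by (rule permutes_inj)
    have "bij_betw (\<lambda>\<pi>. \<sigma> \<circ> \<pi>) {\<pi> \<in> PV. q \<pi> = (A, B)} {\<pi> \<in> PV. q \<pi> = p}"
    proof (rule bij_betwI[where g = "\<lambda>\<pi>. inv \<sigma> \<circ> \<pi>"])
      show "(\<lambda>\<pi>. \<sigma> \<circ> \<pi>) \<in> {\<pi> \<in> PV. q \<pi> = (A, B)} \<rightarrow> {\<pi> \<in> PV. q \<pi> = p}"
      proof (rule funcsetI, unfold mem_Collect_eq, elim conjE)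
        fix \<pi> assume "\<pi> \<in> PV" "q \<pi> = (A, B)"
        then have "\<pi> permutes V" "\<pi> ` A = A" "\<pi> ` B = B" by (auto simp: PV_def q_def)
        moreover have "(\<sigma> \<circ> \<pi>) ` Y = \<sigma> ` (\<pi> ` Y)" for Y by (simp add: image_comp)
        ultimately show "\<sigma> \<circ> \<pi> \<in> PV \<and> q (\<sigma> \<circ> \<pi>) = p"
          using \<sigma> permutes_compose[of \<pi> V \<sigma>] by (simp only: PV_def q_def p mem_Collect_eq)
      qed
      show "(\<lambda>\<pi>. inv \<sigma> \<circ> \<pi>) \<in> {\<pi> \<in> PV. q \<pi> = p} \<rightarrow> {\<pi> \<in> PV. q \<pi> = (A, B)}"
      proof (rule funcsetI, unfold mem_Collect_eq, elim conjE)
        fix \<pi> assume "\<pi> \<in> PV" "q \<pi> = p"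
        then have "\<pi> permutes V" "\<pi> ` A = S" "\<pi> ` B = z" by (auto simp: PV_def q_def p)
        moreover have "inv \<sigma> ` S = A" "inv \<sigma> ` z = B"
          using \<sigma> inj by (metis image_inv_f_f)+
        moreover have "(inv \<sigma> \<circ> \<pi>) ` Y = inv \<sigma> ` (\<pi> ` Y)" for Y by (simp add: image_comp)
        ultimately show "inv \<sigma> \<circ> \<pi> \<in> PV \<and> q (inv \<sigma> \<circ> \<pi>) = (A, B)"
          using permutes_compose[of \<pi> V "inv \<sigma>"] permutes_inv[OF \<sigma>(1)]
          by (simp only: PV_def q_def mem_Collect_eq)
      qed
      show "inv \<sigma> \<circ> (\<sigma> \<circ> \<pi>) = \<pi>" for \<pi> using inj by (simp add: o_assoc)
      show "\<sigma> \<circ> (inv \<sigma> \<circ> \<pi>) = \<pi>" for \<pi> using permutes_inv_o(1)[OF \<sigma>(1)] by (simp add: o_assoc)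
    qed
    from bij_betw_same_card[OF this] show ?thesis unfolding c_def by (rule sym)
  qed
  have grp: "(\<Sum>\<pi>\<in>PV. F (q \<pi>)) = real c * (\<Sum>p\<in>pairs. F p)" for F :: "'a set \<times> 'a set \<Rightarrow> real"
  proof -
    have "(\<Sum>\<pi>\<in>PV. F (q \<pi>)) = (\<Sum>p\<in>pairs. \<Sum>\<pi>\<in>{\<pi> \<in> PV. q \<pi> = p}. F (q \<pi>))"
      by (rule sum.group[symmetric]) (use finPV finp qimg in auto)
    also have "\<dots> = (\<Sum>p\<in>pairs. real c * F p)"
      by (rule sum.cong) (use fiber in auto)
    finally show ?thesis by (simp add: sum_distrib_left)
  qed
  \<comment> \<open>Summing the constant 1 determines the fibre size \<open>c\<close> without
    computing a stabiliser.\<close>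
  have "fact (card V) = real c * real (card pairs)"
    using grp[of "\<lambda>_. 1"] card_permutations[OF refl V] by (simp add: PV_def)
  moreover have "(fact (card V) :: real) \<noteq> 0" by simp
  ultimately have "real c \<noteq> 0" "fact (card V) = real c * real (card pairs)" by auto
  then have "perm_avg V (\<lambda>\<pi>. f (\<pi> ` A) (\<pi> ` B)) = (\<Sum>p\<in>pairs. f (fst p) (snd p)) / real (card pairs)"
    using grp[of "\<lambda>p. f (fst p) (snd p)"] by (simp add: perm_avg_def PV_def q_def)
  then show ?thesis unfolding cp by (simp add: pairs_def a_def b_def)
qed

lemma perm_avg_pair:
  assumes V: "finite V" and sub: "A \<subseteq> V" "B \<subseteq> V" and disj: "A \<inter> B = {}"
    and F: "F \<subseteq> nsets V (card A)" and G: "G \<subseteq> nsets V (card B)"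
  shows "perm_avg V (\<lambda>\<pi>. of_bool (\<pi> ` A \<in> F \<and> \<pi> ` B \<in> G))
     = real (card {(S, z). S \<in> F \<and> z \<in> G \<and> S \<inter> z = {}}) /
       (real (card V choose card B) * real (card V - card B choose card A))"
proof -
  let ?P = "{(S, z). S \<in> nsets V (card A) \<and> z \<in> nsets V (card B) \<and> S \<inter> z = {}}"
  have "finite ?P"
    by (rule finite_subset[of _ "nsets V (card A) \<times> nsets V (card B)"]) (use V in \<open>auto simp: finite_imp_finite_nsets\<close>)
  moreover have "?P \<inter> {p. fst p \<in> F \<and> snd p \<in> G} = {(S, z). S \<in> F \<and> z \<in> G \<and> S \<inter> z = {}}"
    using F G by auto
  ultimately show ?thesis
    using perm_avg_image_pair[OF V sub disj, of "\<lambda>S z. of_bool (S \<in> F \<and> z \<in> G)"] by simp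
qed

lemma perm_avg_single:
  assumes V: "finite V" and A: "A \<subseteq> V" and F: "F \<subseteq> nsets V (card A)"
  shows "perm_avg V (\<lambda>\<pi>. of_bool (\<pi> ` A \<in> F)) = set_density V (card A) F"
proof -
  \<comment> \<open>A single block is the case of an empty second block, whose only image is the
    empty set.\<close>
  have "{(S, z). S \<in> F \<and> z \<in> {{}} \<and> S \<inter> z = {}} = (\<lambda>S. (S, {})) ` F" by auto
  moreover have "card ((\<lambda>S. (S, {} :: 'a set)) ` F) = card F" by (rule card_image) (simp add: inj_on_def)
  ultimately show ?thesis
    using perm_avg_pair[OF V A, of "{}" F "{{}}"] F by (simp add: set_density_def)
qed

lemma perm_avg_mixing:
  assumes V: "finite V" and sub: "A \<subseteq> V" "B \<subseteq> V" and disj: "A \<inter> B = {}"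
    and c: "card A = a" "card B = b" "a < card V" "b < card V"
    and F: "F \<subseteq> nsets V a" and G: "G \<subseteq> nsets V b"
  shows "(perm_avg V (\<lambda>\<pi>. of_bool (\<pi> ` A \<in> F \<and> \<pi> ` B \<in> G)) - set_density V a F * set_density V b G)\<^sup>2
     \<le> (real a * real b / (real (card V - a) * real (card V - b)))
        * (set_density V a F * (1 - set_density V a F)) * (set_density V b G * (1 - set_density V b G))"
proof -
  have "card (A \<union> B) \<le> card V" using V sub by (intro card_mono) auto
  then have "a + b \<le> card V"
    using disj sub V finite_subset c by (subst (asm) card_Un_disjoint) auto
  from disjointness_mixing[OF V this c(3,4) F G] show ?thesis
    using perm_avg_pair[OF V sub disj] F G c by simp
qed

section \<open>Shifted families\<close>

text \<open>Nonemptiness makes pairwise disjoint members distinct, so that the image has as many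
  elements as the index set.\<close>

lemma matching_in_indexed:
  assumes "finite I" "\<And>i. i \<in> I \<Longrightarrow> g i \<in> \<A>" "\<And>i. i \<in> I \<Longrightarrow> g i \<noteq> {}"
    and "\<And>i j. i \<in> I \<Longrightarrow> j \<in> I \<Longrightarrow> i \<noteq> j \<Longrightarrow> g i \<inter> g j = {}"
  shows "matching_in \<A> (card I) (g ` I)"
proof -
  have "inj_on g I" using assms by (metis inf.idem inj_onI)
  moreover have "disjoint (g ` I)" unfolding disjoint_def using assms(4) by (metis imageE)
  ultimately show ?thesis using assms by (auto simp: matching_in_def card_image)
qed

lemma matching_in_insert:
  assumes "matching_in \<A> s M" "F \<in> \<A>" "F \<notin> M" "\<And>G. G \<in> M \<Longrightarrow> G \<inter> F = {}"
  shows "matching_in \<A> (Suc s) (insert F M)"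
  using assms by (auto simp: matching_in_def disjoint_def)

lemma matching_in_subset:
  assumes "matching_in \<B> s M" "N \<subseteq> M" "N \<subseteq> \<A>"
  shows "matching_in \<A> (card N) N"
  using assms finite_subset[of N M] unfolding matching_in_def disjoint_def by blast

section \<open>The shift operation and its effect on matchings\<close>

definition shift_map :: "'a set set \<Rightarrow> 'a \<Rightarrow> 'a \<Rightarrow> 'a set \<Rightarrow> 'a set" where
  "shift_map \<A> i j F = (if j \<in> F \<and> i \<notin> F \<and> insert i (F - {j}) \<notin> \<A> then insert i (F - {j}) else F)"

definition shift :: "'a set set \<Rightarrow> 'a \<Rightarrow> 'a \<Rightarrow> 'a set set" where
  "shift \<A> i j = shift_map \<A> i j ` \<A>"

text \<open>Sets containing exactly one of \<open>i\<close> and \<open>j\<close> come in pairs,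
  exchanged by swapping the two points. If only one member of a pair is in the family, the shifted
  family has the one containing \<open>i\<close>; hence a disjunction in one case and a conjunction
  in the other.\<close>

lemma mem_shift_iff:
  assumes "i \<noteq> j"
  shows "F \<in> shift \<A> i j \<longleftrightarrow>
    (if i \<in> F \<and> j \<notin> F then F \<in> \<A> \<or> insert j (F - {i}) \<in> \<A>
     else if j \<in> F \<and> i \<notin> F then F \<in> \<A> \<and> insert i (F - {j}) \<in> \<A>
     else F \<in> \<A>)" (is "_ \<longleftrightarrow> ?R")
proof
  assume "F \<in> shift \<A> i j"
  then obtain F' where F': "F' \<in> \<A>" "F = shift_map \<A> i j F'" by (auto simp: shift_def)
  show ?R
  proof (cases "j \<in> F' \<and> i \<notin> F' \<and> insert i (F' - {j}) \<notin> \<A>")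
    case True
    then have "F = insert i (F' - {j})" "insert j (F - {i}) = F'"
      using F' assms by (auto simp: shift_map_def)
    then show ?thesis using F' True assms by auto
  next
    case False
    then show ?thesis using F' by (auto simp: shift_map_def)
  qed
next
  have keep: "F \<in> shift \<A> i j" if "F \<in> \<A>" "\<not> (j \<in> F \<and> i \<notin> F \<and> insert i (F - {j}) \<notin> \<A>)"
    using that by (force simp: shift_def shift_map_def)
  assume ?R
  then consider "F \<in> \<A>" "\<not> (j \<in> F \<and> i \<notin> F \<and> insert i (F - {j}) \<notin> \<A>)"
    | "i \<in> F" "j \<notin> F" "F \<notin> \<A>" "insert j (F - {i}) \<in> \<A>" by (auto split: if_splits)
  then show "F \<in> shift \<A> i j"
  proof cases
    case 2
    have "insert i (insert j (F - {i}) - {j}) = F" using 2 assms by auto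
    then have "shift_map \<A> i j (insert j (F - {i})) = F"
      using 2 assms by (auto simp: shift_map_def)
    then show ?thesis using 2 unfolding shift_def by (metis imageI)
  qed (rule keep)
qed

lemma inj_on_shift_map: "inj_on (shift_map \<A> i j) \<A>"
proof (rule inj_onI)
  fix F G assume FG: "F \<in> \<A>" "G \<in> \<A>" "shift_map \<A> i j F = shift_map \<A> i j G"
  let ?m = "\<lambda>F. j \<in> F \<and> i \<notin> F \<and> insert i (F - {j}) \<notin> \<A>"
  consider "?m F" "?m G" | "?m F" "\<not> ?m G" | "\<not> ?m F" "?m G" | "\<not> ?m F" "\<not> ?m G" by blast
  then show "F = G"
  proof cases
    case 1
    then have eq: "insert i (F - {j}) = insert i (G - {j})" using FG(3) unfolding shift_map_def by presburger
    have "F = insert j (insert i (F - {j}) - {i})" "G = insert j (insert i (G - {j}) - {i})" using 1 by auto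
    then show ?thesis using eq by simp
  next
    case 2
    then show ?thesis using FG unfolding shift_map_def by (metis)
  next
    case 3
    then show ?thesis using FG unfolding shift_map_def by (metis)
  next
    case 4
    then show ?thesis using FG(3) unfolding shift_map_def by presburger
  qed
qed

lemma card_shift: "card (shift \<A> i j) = card \<A>"
  unfolding shift_def by (rule card_image[OF inj_on_shift_map])

lemma shift_subset_nsets:
  assumes "\<A> \<subseteq> nsets V k" "i \<in> V"
  shows "shift \<A> i j \<subseteq> nsets V k"
proof
  fix F assume "F \<in> shift \<A> i j"
  then obtain F' where F': "F' \<in> \<A>" "F = shift_map \<A> i j F'" by (auto simp: shift_def)
  then have N: "F' \<subseteq> V" "finite F'" "card F' = k" using assms(1) by (auto simp: nsets_def)
  have "card (insert i (F' - {j})) = k" if "j \<in> F'" "i \<notin> F'"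
    using that N card_Suc_Diff1[of F' j] by (simp add: card_insert_if)
  then show "F \<in> nsets V k" using F' N assms(2) by (auto simp: shift_map_def nsets_def)
qed

text \<open>At most one member \<open>F1\<close> of the matching is new, because new sets contain
  \<open>i\<close>. Replace \<open>i\<close> by \<open>j\<close> in it. If another member
  \<open>F2\<close> contains \<open>j\<close>, it survived the shift only because its version with
  \<open>i\<close> is in the family as well, so the two points can be exchanged between
  \<open>F1\<close> and \<open>F2\<close>.\<close>

lemma matching_in_shift:
  assumes ij: "i \<noteq> j" and M: "matching_in (shift \<A> i j) s M"
  shows "\<exists>M'. matching_in \<A> s M'"
proof (cases "M \<subseteq> \<A>")
  case True
  then show ?thesis using M by (auto simp: matching_in_def)
next
  case False
  have fin: "finite M" "card M = s" and sub: "M \<subseteq> shift \<A> i j"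
    and dis: "\<And>F G. F \<in> M \<Longrightarrow> G \<in> M \<Longrightarrow> F \<noteq> G \<Longrightarrow> F \<inter> G = {}"
    using M by (auto simp: matching_in_def disjoint_def)
  obtain F1 where F1: "F1 \<in> M" "F1 \<notin> \<A>" using False by blast
  define F1' where "F1' = insert j (F1 - {i})"
  have F1': "i \<in> F1" "j \<notin> F1" "F1' \<in> \<A>"
    using F1 sub mem_shift_iff[OF ij, of F1 \<A>] by (auto simp: F1'_def split: if_splits)
  have oth: "F \<in> \<A>" "i \<notin> F" if "F \<in> M" "F \<noteq> F1" for F
  proof -
    show "i \<notin> F" using dis[OF that(1) F1(1) that(2)] F1' by auto
    then show "F \<in> \<A>" using that sub mem_shift_iff[OF ij, of F \<A>] by (auto split: if_splits)
  qed
  show ?thesis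
  proof (cases "\<exists>F2\<in>M. j \<in> F2")
    case False
    let ?M = "insert F1' (M - {F1})"
    have "matching_in \<A> (card (M - {F1})) (M - {F1})"
      using M oth by (intro matching_in_subset) auto
    then have "matching_in \<A> (Suc (card (M - {F1}))) ?M"
    proof (rule matching_in_insert)
      show "F1' \<notin> M - {F1}" using False by (auto simp: F1'_def)
      show "F \<inter> F1' = {}" if "F \<in> M - {F1}" for F
        using that dis[of F F1] F1 False by (auto simp: F1'_def)
    qed (rule F1')
    then show ?thesis using card_Suc_Diff1[OF fin(1) F1(1)] fin(2) by auto
  next
    case True
    then obtain F2 where F2: "F2 \<in> M" "j \<in> F2" by blast
    then have ne: "F2 \<noteq> F1" using F1' by auto
    define F2' where "F2' = insert i (F2 - {j})"
    have F2': "i \<notin> F2" "F2' \<in> \<A>"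
      using oth[OF F2(1) ne] F2 sub mem_shift_iff[OF ij, of F2 \<A>] by (auto simp: F2'_def split: if_splits)
    let ?R = "M - {F1, F2}"
    let ?M = "insert F1' (insert F2' ?R)"
    have R: "F \<inter> F1 = {}" "F \<inter> F2 = {}" "i \<notin> F" "j \<notin> F" if "F \<in> ?R" for F
      using that dis[of F F1] dis[of F F2] F1 F2 F1' by auto
    have d12: "F1' \<inter> F2' = {}" using dis[OF F1(1) F2(1)] ne ij by (auto simp: F1'_def F2'_def)
    have "j \<in> F1'" "i \<in> F2'" by (auto simp: F1'_def F2'_def)
    then have "F1' \<notin> ?R" "F2' \<notin> ?R" "F1' \<noteq> F2'" using R(3,4) d12 by blast+
    moreover have RF: "F \<inter> F1' = {}" "F \<inter> F2' = {}" if "F \<in> ?R" for F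
      using R[OF that] by (auto simp: F1'_def F2'_def)
    moreover have "matching_in \<A> (card ?R) ?R"
      using M oth by (intro matching_in_subset) auto
    ultimately have "matching_in \<A> (Suc (card ?R)) (insert F2' ?R)"
      using F2' by (intro matching_in_insert) auto
    then have "matching_in \<A> (Suc (Suc (card ?R))) ?M"
    proof (rule matching_in_insert)
      show "F1' \<notin> insert F2' ?R" using \<open>F1' \<notin> ?R\<close> \<open>F1' \<noteq> F2'\<close> by blast
      show "F \<inter> F1' = {}" if "F \<in> insert F2' ?R" for F
        using that RF d12 by (auto simp: Int_commute)
    qed (rule F1')
    moreover have "Suc (Suc (card ?R)) = s"
    proof -
      have "?R = M - {F1} - {F2}" by auto
      then show ?thesis
        using card_Suc_Diff1[OF fin(1) F1(1)] card_Suc_Diff1[of "M - {F1}" F2] fin F2 ne by simp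
    qed
    ultimately show ?thesis by auto
  qed
qed

text \<open>The potential that drops with every proper shift; it drives the induction of
  \<open>ex_near_star\<close>.\<close>

definition family_weight :: "nat set set \<Rightarrow> nat" where
  "family_weight \<A> = (\<Sum>F\<in>\<A>. \<Sum>F)"

lemma family_weight_shift_less:
  assumes fin: "finite \<A>" "\<And>F. F \<in> \<A> \<Longrightarrow> finite F" and ij: "i < j" and ne: "shift \<A> i j \<noteq> \<A>"
  shows "family_weight (shift \<A> i j) < family_weight \<A>"
proof -
  have mv: "\<Sum>(insert i (F - {j})) < \<Sum>F" if "F \<in> \<A>" "j \<in> F" "i \<notin> F" for F
    using that fin(2)[OF that(1)] ij sum.remove[of F j "\<lambda>x. x"] by simp
  have "\<exists>F\<in>\<A>. shift_map \<A> i j F \<noteq> F"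
  proof (rule ccontr)
    assume "\<not> ?thesis"
    then have "shift \<A> i j = (\<lambda>F. F) ` \<A>" unfolding shift_def by (intro image_cong) auto
    then show False using ne by simp
  qed
  then obtain F where F: "F \<in> \<A>" "shift_map \<A> i j F \<noteq> F" by blast
  have "family_weight (shift \<A> i j) = (\<Sum>F\<in>\<A>. \<Sum>(shift_map \<A> i j F))"
    unfolding family_weight_def shift_def by (subst sum.reindex[OF inj_on_shift_map]) simp
  also have "\<dots> < family_weight \<A>" unfolding family_weight_def
  proof (rule sum_strict_mono_ex1[OF fin(1)])
    show "\<forall>F\<in>\<A>. \<Sum>(shift_map \<A> i j F) \<le> \<Sum>F" using mv by (auto simp: shift_map_def intro: less_imp_le)
    show "\<exists>F\<in>\<A>. \<Sum>(shift_map \<A> i j F) < \<Sum>F"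
      using F mv by (intro bexI[of _ F]) (auto simp: shift_map_def split: if_splits)
  qed
  finally show ?thesis .
qed

section \<open>Left-shifted families and their shadows\<close>

definition shifted :: "nat set set \<Rightarrow> bool" where
  "shifted \<A> \<longleftrightarrow> (\<forall>F\<in>\<A>. \<forall>i j. 0 < i \<and> i < j \<and> j \<in> F \<and> i \<notin> F \<longrightarrow> insert i (F - {j}) \<in> \<A>)"

lemma shiftedD:
  "shifted \<A> \<Longrightarrow> F \<in> \<A> \<Longrightarrow> 0 < i \<Longrightarrow> i < j \<Longrightarrow> j \<in> F \<Longrightarrow> i \<notin> F \<Longrightarrow> insert i (F - {j}) \<in> \<A>"
  by (simp add: shifted_def)

lemma shifted_if_shift_eq:
  assumes "\<A> \<subseteq> nsets {1..n} k"
    and "\<And>i j. 0 < i \<Longrightarrow> i < j \<Longrightarrow> j \<le> n \<Longrightarrow> shift \<A> i j = \<A>"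
  shows "shifted \<A>"
  unfolding shifted_def
proof (intro ballI allI impI, elim conjE)
  fix F i j assume F: "F \<in> \<A>" "0 < i" "i < j" "j \<in> F" "i \<notin> F"
  then have "F \<in> nsets {1..n} k" using assms(1) by blast
  then have "j \<le> n" using F by (auto simp: nsets_def)
  then have "F \<in> shift \<A> i j" using assms(2) F by simp
  then show "insert i (F - {j}) \<in> \<A>" using F mem_shift_iff[of i j F \<A>] by auto
qed

text \<open>The prefix condition says that the elements of \<open>Q\<close>, in increasing order,
  are at most those of \<open>F\<close>. Exchanging the least element of \<open>F - Q\<close> for
  the least of \<open>Q - F\<close> is a move to the left, preserves the condition and brings
  \<open>F\<close> closer to \<open>Q\<close>.\<close>

lemma shifted_dominated:
  assumes sh: "shifted \<A>" and F: "F \<in> \<A>" "finite F" and Q: "finite Q" "0 \<notin> Q" "card Q = card F"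
    and dom: "\<And>m. card (F \<inter> {..m}) \<le> card (Q \<inter> {..m})"
  shows "Q \<in> \<A>"
  using F Q(3) dom
proof (induction "card (F - Q)" arbitrary: F)
  case 0
  then have "F \<subseteq> Q" by auto
  then have "F = Q" using 0 Q by (simp add: card_subset_eq)
  then show ?case using 0 by simp
next
  case (Suc d)
  have neF: "F - Q \<noteq> {}" using Suc(2) by (metis card.empty nat.distinct(1))
  have "\<not> Q \<subseteq> F" using Suc neF by (metis Diff_eq_empty_iff card_subset_eq order_refl)
  then have neQ: "Q - F \<noteq> {}" by blast
  define y where "y = Min (F - Q)"
  define x where "x = Min (Q - F)"
  have y: "y \<in> F" "y \<notin> Q" using Min_in[of "F - Q"] neF Suc(4) by (auto simp: y_def)
  have x: "x \<in> Q" "x \<notin> F" using Min_in[of "Q - F"] neQ Q(1) by (auto simp: x_def)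
  have ymin: "z \<in> Q" if "z \<in> F" "z < y" for z
  proof (rule ccontr)
    assume "z \<notin> Q"
    then have "y \<le> z" unfolding y_def using that Suc(4) by (intro Min_le) auto
    then show False using that by simp
  qed
  have xmin: "z \<in> F" if "z \<in> Q" "z < x" for z
  proof (rule ccontr)
    assume "z \<notin> F"
    then have "x \<le> z" unfolding x_def using that Q by (intro Min_le) auto
    then show False using that by simp
  qed
  have xy: "x < y"
  proof (rule ccontr)
    assume "\<not> x < y"
    moreover have "x \<noteq> y" using x y by auto
    ultimately have "y < x" by simp
    then have "Q \<inter> {..y} \<subset> F \<inter> {..y}" using xmin y by auto
    then have "card (Q \<inter> {..y}) < card (F \<inter> {..y})" by (intro psubset_card_mono) auto
    then show False using Suc(6)[of y] by simp
  qed
  define F' where "F' = insert x (F - {y})"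
  have "0 < x" using x Q(2) by (metis neq0_conv)
  then have F'A: "F' \<in> \<A>" using sh Suc(3) x y xy unfolding shifted_def F'_def by blast
  have fin: "finite F'" using Suc(4) by (simp add: F'_def)
  have "card F' = card F" using x y Suc(4) card_Suc_Diff1[of F y] by (simp add: F'_def)
  moreover have "d = card (F' - Q)"
  proof -
    have "F' - Q = (F - Q) - {y}" using x by (auto simp: F'_def)
    then show ?thesis using Suc(2) y Suc(4) by simp
  qed
  moreover have "card (F' \<inter> {..m}) \<le> card (Q \<inter> {..m})" for m
  proof -
    consider "m < x" | "x \<le> m" "m < y" | "y \<le> m" by linarith
    then show ?thesis
    proof cases
      case 1
      then have "F' \<inter> {..m} = F \<inter> {..m}" using xy by (auto simp: F'_def)
      then show ?thesis using Suc(6) by simp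
    next
      case 2
      \<comment> \<open>The count of \<open>F'\<close> has gone up by one here, but every element of
        \<open>F\<close> below \<open>y\<close> lies in \<open>Q\<close>, and so does
        \<open>x\<close>.\<close>
      then have "F' \<inter> {..m} \<subseteq> Q \<inter> {..m}" using ymin x by (auto simp: F'_def)
      then show ?thesis by (intro card_mono) auto
    next
      case 3
      then have "F' \<inter> {..m} = insert x (F \<inter> {..m} - {y})" using xy by (auto simp: F'_def)
      moreover have "card (insert x (F \<inter> {..m} - {y})) = card (F \<inter> {..m})"
        using x y 3 Suc(4) card_Suc_Diff1[of "F \<inter> {..m}" y] by simp
      ultimately show ?thesis using Suc(6) by simp
    qed
  qed
  ultimately show ?case using Suc(1)[of F'] F'A fin Suc(5) by simp
qed

text \<open>Otherwise the \<open>i\<close>-th smallest element of \<open>F\<close> is at least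
  \<open>i * (t + 1)\<close> for every \<open>i\<close>. Then \<open>F\<close> is dominated by each
  of the \<open>t + 1\<close> progressions \<open>Q l\<close> with difference \<open>t + 1\<close>,
  which partition the first \<open>k * (t + 1)\<close> integers and would form a matching.\<close>

lemma shifted_prefix:
  assumes A: "\<A> \<subseteq> nsets {1..n} k" and sh: "shifted \<A>" and nm: "\<not> (\<exists>M. matching_in \<A> (t + 1) M)"
    and F: "F \<in> \<A>" and k: "0 < k"
  shows "\<exists>i. 1 \<le> i \<and> i \<le> k \<and> i \<le> card (F \<inter> {1..i * (t + 1) - 1})"
proof (rule ccontr)
  assume "\<not> ?thesis"
  then have small: "card (F \<inter> {1..i * (t + 1) - 1}) < i" if "1 \<le> i" "i \<le> k" for i
    using that by (meson not_less)
  have FF: "finite F" "card F = k" "F \<subseteq> {1..n}" using A F by (auto simp: nsets_def)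
  define Q where "Q l = (\<lambda>i. (i - 1) * (t + 1) + l) ` {1..k}" for l
  have inj: "inj_on (\<lambda>i. (i - 1) * (t + 1) + l) {1..k}" for l :: nat
  proof (rule inj_onI)
    fix x y assume xy: "x \<in> {1..k}" "y \<in> {1..k}" "(x - 1) * (t + 1) + l = (y - 1) * (t + 1) + l"
    then have "(x - 1) * (t + 1) = (y - 1) * (t + 1)" by (simp only: add_right_cancel)
    then have "x - 1 = y - 1" by (simp only: mult_cancel2) simp
    then show "x = y" using xy by auto
  qed
  have QA: "Q l \<in> \<A>" if l: "l \<in> {1..t + 1}" for l
  proof (rule shifted_dominated[OF sh F FF(1)])
    show "finite (Q l)" "0 \<notin> Q l" using l by (auto simp: Q_def)
    show "card (Q l) = card F" unfolding Q_def card_image[OF inj] FF(2) by simp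
    show "card (F \<inter> {..m}) \<le> card (Q l \<inter> {..m})" for m
    proof -
      define q where "q = min k (m div (t + 1))"
      have "(\<lambda>i. (i - 1) * (t + 1) + l) ` {1..q} \<subseteq> Q l \<inter> {..m}"
      proof
        fix x assume "x \<in> (\<lambda>i. (i - 1) * (t + 1) + l) ` {1..q}"
        then obtain i where x: "x = (i - 1) * (t + 1) + l" and i: "1 \<le> i" "i \<le> q" by auto
        have "x \<in> Q l" unfolding Q_def x using i by (intro imageI) (auto simp: q_def)
        have "(i - 1) * (t + 1) + l \<le> i * (t + 1)" using i l by (cases i) auto
        also have "\<dots> \<le> (m div (t + 1)) * (t + 1)" using i by (intro mult_right_mono) (auto simp: q_def)
        also have "\<dots> \<le> m" by (rule div_times_less_eq_dividend)
        finally show "x \<in> Q l \<inter> {..m}" using \<open>x \<in> Q l\<close> x by simp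
      qed
      then have "card ((\<lambda>i. (i - 1) * (t + 1) + l) ` {1..q}) \<le> card (Q l \<inter> {..m})"
        by (intro card_mono) auto
      moreover have "card ((\<lambda>i. (i - 1) * (t + 1) + l) ` {1..q}) = q"
      proof (subst card_image)
        show "inj_on (\<lambda>i. (i - 1) * (t + 1) + l) {1..q}"
          by (rule inj_on_subset[OF inj]) (auto simp: q_def)
      qed simp
      moreover have "card (F \<inter> {..m}) \<le> q"
      proof (cases "m div (t + 1) < k")
        case True
        define i where "i = m div (t + 1) + 1"
        have "m < i * (t + 1)" unfolding i_def
          by (metis Suc_eq_plus1 dividend_less_div_times mult.commute mult_Suc zero_less_Suc)
        then have "F \<inter> {..m} \<subseteq> F \<inter> {1..i * (t + 1) - 1}" using FF(3) by auto
        then have "card (F \<inter> {..m}) \<le> card (F \<inter> {1..i * (t + 1) - 1})" by (intro card_mono) auto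
        also have "\<dots> < i" by (rule small) (use True in \<open>auto simp: i_def\<close>)
        finally show ?thesis using True by (simp add: i_def q_def)
      next
        case False
        then have "q = k" by (simp add: q_def)
        then show ?thesis using FF card_mono[of F "F \<inter> {..m}"] by simp
      qed
      ultimately show ?thesis by simp
    qed
  qed
  have res: "l = l'" if "(i - 1) * (t + 1) + l = (i' - 1) * (t + 1) + l'" "l \<in> {1..t + 1}" "l' \<in> {1..t + 1}" for i i' l l' :: nat
  proof -
    have m: "((i - 1) * (t + 1) + l - 1) mod (t + 1) = l - 1" if "l \<in> {1..t + 1}" for i l :: nat
    proof -
      have "(i - 1) * (t + 1) + l - 1 = (l - 1) + (i - 1) * (t + 1)" using that by auto
      then have "((i - 1) * (t + 1) + l - 1) mod (t + 1) = (l - 1) mod (t + 1)" by (simp only: mod_mult_self1)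
      also have "\<dots> = l - 1" using that by (intro mod_less) auto
      finally show ?thesis .
    qed
    have "l - 1 = l' - 1" using m[OF that(2), of i] m[OF that(3), of i'] that(1) by simp
    then show ?thesis using that by auto
  qed
  have "matching_in \<A> (card {1..t + 1}) (Q ` {1..t + 1})"
  proof (rule matching_in_indexed)
    show "Q i \<noteq> {}" for i using k by (auto simp: Q_def)
    show "Q l \<inter> Q l' = {}" if "l \<in> {1..t + 1}" "l' \<in> {1..t + 1}" "l \<noteq> l'" for l l'
    proof (rule ccontr)
      assume "Q l \<inter> Q l' \<noteq> {}"
      then obtain x where "x \<in> Q l" "x \<in> Q l'" by blast
      then obtain i i' where "x = (i - 1) * (t + 1) + l" "x = (i' - 1) * (t + 1) + l'"
        unfolding Q_def by blast
      then show False using res[of i l i' l'] that by simp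
    qed
  qed (use QA in auto)
  then show False using nm by auto
qed

text \<open>Frankl's bound \<open>|\<F>| \<le> t |\<partial>\<F>|\<close>. A set \<open>F\<close> is charged to the sets \<open>F - {x}\<close> with \<open>x < i (t + 1)\<close>,
  where \<open>i\<close> is the last index with \<open>|F \<inter> [i (t + 1) - 1]| \<ge> i\<close>; the point is that \<open>i\<close> is determined by \<open>F - {x}\<close>.\<close>

lemma shifted_shadow:
  assumes A: "\<A> \<subseteq> nsets {1..n} k" and sh: "shifted \<A>" and nm: "\<not> (\<exists>M. matching_in \<A> (t + 1) M)"
    and k: "0 < k" and F: "\<F> \<subseteq> \<A>" and G: "finite \<G>" "\<And>F x. F \<in> \<F> \<Longrightarrow> x \<in> F \<Longrightarrow> F - {x} \<in> \<G>"
  shows "card \<F> \<le> t * card \<G>"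
proof -
  define thr where "thr i = i * (t + 1) - 1" for i
  have thr_mono: "thr i \<le> thr i'" if "i \<le> i'" for i i' unfolding thr_def using that
    by (intro diff_le_mono mult_right_mono) auto
  \<comment> \<open>Index 0 always qualifies, so the maximum is over a nonempty set;
    \<open>shifted_prefix\<close> makes it positive. The \<open>+ 1\<close> in \<open>idx'\<close>
    compensates for the deleted point.\<close>
  define idx where "idx F = Max {i. i \<le> k \<and> i \<le> card (F \<inter> {1..thr i})}" for F
  define idx' where "idx' E = Max {i. i \<le> k \<and> i \<le> card (E \<inter> {1..thr i}) + 1}" for E
  have finF: "finite \<F>" using F A finite_subset finite_imp_finite_nsets[of "{1..n}" k]
    by (meson finite_atLeastAtMost)
  have FF: "finite F" "card F = k" "F \<subseteq> {1..n}" if "F \<in> \<F>" for F using that A F by (auto simp: nsets_def)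
  have idx: "idx F \<le> k \<and> 1 \<le> idx F \<and> card (F \<inter> {1..thr (idx F)}) = idx F
      \<and> (\<forall>i. idx F < i \<and> i \<le> k \<longrightarrow> card (F \<inter> {1..thr i}) < i)" if F': "F \<in> \<F>" for F
  proof -
    let ?S = "{i. i \<le> k \<and> i \<le> card (F \<inter> {1..thr i})}"
    have finS: "finite ?S" by (rule finite_subset[of _ "{..k}"]) auto
    obtain i where i: "1 \<le> i" "i \<in> ?S"
      using shifted_prefix[OF A sh nm _ k, of F] F' F unfolding thr_def by blast
    then have in_S: "idx F \<in> ?S" unfolding idx_def by (intro Max_in finS) auto
    have ge: "i' \<le> idx F" if "i' \<in> ?S" for i' unfolding idx_def using that by (intro Max_ge finS)
    have out: "card (F \<inter> {1..thr i}) < i" if "idx F < i" "i \<le> k" for i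
    proof (rule ccontr)
      assume "\<not> ?thesis"
      then have "i \<in> ?S" using that by simp
      then show False using ge[of i] that by simp
    qed
    \<comment> \<open>Equality holds at the last good index: the next index fails, and the counts
      increase with the threshold.\<close>
    have "card (F \<inter> {1..thr (idx F)}) \<le> idx F"
    proof (cases "idx F = k")
      case True
      then show ?thesis using FF[OF F'] card_mono[of F "F \<inter> {1..thr (idx F)}"] by simp
    next
      case False
      then have "Suc (idx F) \<le> k" using in_S by auto
      then have "card (F \<inter> {1..thr (Suc (idx F))}) < Suc (idx F)" by (intro out) auto
      moreover have "card (F \<inter> {1..thr (idx F)}) \<le> card (F \<inter> {1..thr (Suc (idx F))})"
        using thr_mono[of "idx F" "Suc (idx F)"] by (intro card_mono) auto
      ultimately show ?thesis by simp
    qed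
    then show ?thesis using in_S ge[OF i(2)] i(1) out by auto
  qed
  have del: "idx' (F - {x}) = idx F \<and> card ((F - {x}) \<inter> {1..thr (idx F)}) = idx F - 1"
    if F': "F \<in> \<F>" and x: "x \<in> F \<inter> {1..thr (idx F)}" for F x
  proof -
    have c: "card ((F - {x}) \<inter> {1..thr i}) + 1 = card (F \<inter> {1..thr i})" if "idx F \<le> i" for i
    proof -
      have "(F - {x}) \<inter> {1..thr i} = F \<inter> {1..thr i} - {x}" by auto
      moreover have "x \<in> F \<inter> {1..thr i}" using x thr_mono[OF that] by auto
      ultimately show ?thesis using card_Suc_Diff1[of "F \<inter> {1..thr i}" x] by simp
    qed
    have "idx' (F - {x}) = idx F" unfolding idx'_def
    proof (rule Max_eqI)
      show "finite {i. i \<le> k \<and> i \<le> card ((F - {x}) \<inter> {1..thr i}) + 1}"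
        by (rule finite_subset[of _ "{..k}"]) auto
      show "idx F \<in> {i. i \<le> k \<and> i \<le> card ((F - {x}) \<inter> {1..thr i}) + 1}"
        using idx[OF F'] c[of "idx F"] by simp
      show "i \<le> idx F" if "i \<in> {i. i \<le> k \<and> i \<le> card ((F - {x}) \<inter> {1..thr i}) + 1}" for i
      proof (rule ccontr)
        assume "\<not> i \<le> idx F"
        then have "card (F \<inter> {1..thr i}) < i" using that idx[OF F'] by simp
        then show False using that c[of i] \<open>\<not> i \<le> idx F\<close> by simp
      qed
    qed
    then show ?thesis using c[of "idx F"] idx[OF F'] by simp
  qed
  define S1 where "S1 = (SIGMA F:\<F>. F \<inter> {1..thr (idx F)})"
  \<comment> \<open>\<open>G'\<close> has the shape that \<open>del\<close> gives to a set
    \<open>F - {x}\<close>, and \<open>S2\<close> allows every candidate for the deleted point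
    \<open>x\<close>.\<close>
  define G' where "G' = {E \<in> \<G>. 1 \<le> idx' E \<and> card (E \<inter> {1..thr (idx' E)}) = idx' E - 1}"
  define S2 where "S2 = (SIGMA E:G'. {1..thr (idx' E)} - E)"
  define \<phi> where "\<phi> = (\<lambda>(F, x). (F - {x}, x :: nat))"
  have inj: "inj_on \<phi> S1"
  proof (rule inj_onI, clarsimp simp: S1_def \<phi>_def)
    fix F F' :: "nat set" and x assume "F - {x} = F' - {x}" "x \<in> F" "x \<in> F'"
    then show "F = F'" by (metis insert_Diff)
  qed
  have img: "\<phi> ` S1 \<subseteq> S2"
    using del idx G(2) by (auto simp: S1_def S2_def \<phi>_def G'_def)
  have fin2: "finite S2" unfolding S2_def G'_def using G(1) by auto
  \<comment> \<open>Each \<open>F\<close> spreads a unit of charge evenly over its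
    \<open>idx F\<close> admissible points.\<close>
  have "real (card \<F>) = (\<Sum>F\<in>\<F>. \<Sum>x\<in>F \<inter> {1..thr (idx F)}. 1 / real (idx F))"
  proof -
    have "(\<Sum>x\<in>F \<inter> {1..thr (idx F)}. 1 / real (idx F)) = 1" if "F \<in> \<F>" for F
    proof -
      have "0 < idx F" "card (F \<inter> {1..thr (idx F)}) = idx F" using idx[OF that] by auto
      then show ?thesis by simp
    qed
    then have "(\<Sum>F\<in>\<F>. \<Sum>x\<in>F \<inter> {1..thr (idx F)}. 1 / real (idx F)) = (\<Sum>F\<in>\<F>. 1)"
      by (intro sum.cong refl)
    then show ?thesis by (simp only: sum_constant mult_1_right)
  qed
  also have "\<dots> = (\<Sum>(F, x)\<in>S1. 1 / real (idx F))"
    unfolding S1_def using finF by (subst sum.Sigma) auto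
  also have "\<dots> = (\<Sum>p\<in>S1. (\<lambda>(E, x). 1 / real (idx' E)) (\<phi> p))"
    by (rule sum.cong) (use del in \<open>auto simp: S1_def \<phi>_def\<close>)
  also have "\<dots> = (\<Sum>(E, x)\<in>\<phi> ` S1. 1 / real (idx' E))"
    by (simp add: sum.reindex[OF inj] o_def)
  also have "\<dots> \<le> (\<Sum>(E, x)\<in>S2. 1 / real (idx' E))"
    by (rule sum_mono2[OF fin2 img]) auto
  also have "\<dots> = (\<Sum>E\<in>G'. \<Sum>x\<in>{1..thr (idx' E)} - E. 1 / real (idx' E))"
    unfolding S2_def using G(1) by (subst sum.Sigma) (auto simp: G'_def)
  also have "\<dots> = (\<Sum>E\<in>G'. real t)"
  proof (rule sum.cong)
    fix E assume E: "E \<in> G'"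
    define i where "i = idx' E"
    have i: "1 \<le> i" "card (E \<inter> {1..thr i}) = i - 1" using E by (auto simp: G'_def i_def)
    \<comment> \<open>With \<open>thr i = i * (t + 1) - 1\<close> exactly \<open>i * t\<close>
      points can be restored to \<open>E\<close>; at charge \<open>1 / i\<close> each they
      contribute \<open>t\<close>.\<close>
    have "card ({1..thr i} - E) = thr i - (i - 1)"
      using i card_Diff_subset_Int[of "{1..thr i}" E] by (simp add: Int_commute)
    also have "\<dots> = i * t" using i(1) by (cases i) (auto simp: thr_def)
    finally show "(\<Sum>x\<in>{1..thr (idx' E)} - E. 1 / real (idx' E)) = real t"
      using i(1) by (simp add: i_def[symmetric])
  qed simp
  also have "\<dots> \<le> real (t * card \<G>)"
  proof -
    have "card G' \<le> card \<G>" using G(1) by (intro card_mono) (auto simp: G'_def)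
    then show ?thesis by (simp add: mult.commute mult_left_mono)
  qed
  finally show ?thesis by linarith
qed

text \<open>If at every level \<open>p\<close> more than \<open>t + 1 - p\<close> columns had height
  at least \<open>p\<close>, distinct columns could be chosen greedily from level
  \<open>t + 1\<close> downwards. So some level has few high columns, and a count of low and high
  columns gives the bound.\<close>

lemma nested_columns_bound:
  fixes v :: "'a \<Rightarrow> nat"
  assumes fin: "finite I" and cI: "card I = 2 * t + 1" and v: "\<And>i. i \<in> I \<Longrightarrow> v i \<le> t + 1"
    and nosdr: "\<not> (\<exists>f. inj_on f {1..t + 1} \<and> (\<forall>l\<in>{1..t + 1}. f l \<in> I \<and> l \<le> v (f l)))"
  shows "(\<Sum>i\<in>I. v i) + t * card {i \<in> I. v i = t + 1} \<le> t * (2 * t + 1)"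
proof -
  have "\<exists>p\<in>{1..t + 1}. card {i \<in> I. p \<le> v i} \<le> t + 1 - p"
  proof (rule ccontr)
    assume "\<not> ?thesis"
    then have big: "t + 1 - p < card {i \<in> I. p \<le> v i}" if "p \<in> {1..t + 1}" for p
      using that by (meson not_le)
    have "\<exists>f. inj_on f {t + 2 - d..t + 1} \<and> (\<forall>l\<in>{t + 2 - d..t + 1}. f l \<in> I \<and> l \<le> v (f l))"
      if "d \<le> t + 1" for d
      using that
    proof (induction d)
      case (Suc d)
      then obtain f where f: "inj_on f {t + 2 - d..t + 1}" "\<forall>l\<in>{t + 2 - d..t + 1}. f l \<in> I \<and> l \<le> v (f l)"
        by auto
      define p where "p = t + 1 - d"
      have p: "p \<in> {1..t + 1}" "t + 2 - d = p + 1" "t + 2 - Suc d = p" "t + 1 - p = d"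
        using Suc by (auto simp: p_def)
      have "card (f ` {p + 1..t + 1}) \<le> card {p + 1..t + 1}" by (rule card_image_le) simp
      also have "\<dots> = d" using p by simp
      finally have "card (f ` {p + 1..t + 1}) < card {i \<in> I. p \<le> v i}" using big[OF p(1)] p(4) by simp
      then have "\<not> {i \<in> I. p \<le> v i} \<subseteq> f ` {p + 1..t + 1}"
        by (meson card_mono finite_atLeastAtMost finite_imageI not_le)
      then obtain i where i: "i \<in> I" "p \<le> v i" "i \<notin> f ` {p + 1..t + 1}" by blast
      have seg: "{p..t + 1} = insert p {p + 1..t + 1}" using p(1) by auto
      have "inj_on (f(p := i)) {p..t + 1}" unfolding seg
        using f(1) i(3) unfolding p(2) by (auto simp: inj_on_def)
      moreover have "\<forall>l\<in>{p..t + 1}. (f(p := i)) l \<in> I \<and> l \<le> v ((f(p := i)) l)"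
        unfolding seg using f(2) i unfolding p(2) by auto
      ultimately show ?case unfolding p(3) by blast
    qed auto
    from this[of "t + 1"] show False using nosdr by auto
  qed
  then obtain p where p: "1 \<le> p" "p \<le> t + 1" "card {i \<in> I. p \<le> v i} \<le> t + 1 - p" by auto
  define H where "H = {i \<in> I. p \<le> v i}"
  have "t * card {i \<in> I. v i = t + 1} = (\<Sum>i\<in>I. if v i = t + 1 then t else 0)"
    using fin by (simp add: sum.If_cases Int_def mult.commute)
  then have "(\<Sum>i\<in>I. v i) + t * card {i \<in> I. v i = t + 1} = (\<Sum>i\<in>I. v i + (if v i = t + 1 then t else 0))"
    by (simp add: sum.distrib)
  \<comment> \<open>A low column costs at most \<open>p - 1\<close>, a high one at most
    \<open>(t + 1) + t = (p - 1) + (2 * t + 2 - p)\<close>.\<close>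
  also have "\<dots> \<le> (\<Sum>i\<in>I. (p - 1) + (if i \<in> H then 2 * t + 2 - p else 0))"
    by (rule sum_mono) (use v p in \<open>fastforce simp: H_def\<close>)
  also have "\<dots> = (2 * t + 1) * (p - 1) + card H * (2 * t + 2 - p)"
    using fin cI by (simp add: sum.distrib sum.If_cases Int_def H_def)
  also have "\<dots> \<le> (2 * t + 1) * (p - 1) + (t + 1 - p) * (2 * t + 2 - p)"
    using p(3) by (auto simp: H_def)
  also have "\<dots> \<le> t * (2 * t + 1)"
  proof -
    \<comment> \<open>With \<open>p = a + 1\<close> and \<open>t = a + d\<close> the two sides
      differ by \<open>a * d\<close>, so the bound is attained at both extreme levels.\<close>
    obtain a where a: "p = Suc a" using p(1) by (cases p) auto
    obtain d where d: "t = a + d" using p(2) a by (metis Suc_eq_plus1 Suc_le_mono le_iff_add)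
    show ?thesis unfolding a d by (simp add: algebra_simps)
  qed
  finally show ?thesis .
qed

section \<open>Random disjoint blocks\<close>

lemma perm_avg_add: "perm_avg V (\<lambda>\<pi>. h \<pi> + h' \<pi>) = perm_avg V h + perm_avg V h'"
  by (simp add: perm_avg_def sum.distrib add_divide_distrib)

lemma card_filter_of_bool: "finite A \<Longrightarrow> real (card {x \<in> A. P x}) = (\<Sum>x\<in>A. of_bool (P x))"
  by (simp add: Int_def)

lemma perm_image_nsets:
  assumes "\<pi> permutes V" "finite V" "C \<subseteq> V"
  shows "\<pi> ` C \<in> nsets V (card C)"
proof -
  have "card (\<pi> ` C) = card C" using permutes_inj[OF assms(1)] by (intro card_image) (auto intro: inj_on_subset)
  then show ?thesis
    using assms finite_subset[OF assms(3,2)] permutes_image[OF assms(1)] by (auto simp: nsets_def)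
qed

lemma ex_disjoint_blocks:
  assumes "finite I" and "finite V" and "(\<Sum>i\<in>I. s i) \<le> card V"
  obtains C where "\<And>i. i \<in> I \<Longrightarrow> C i \<subseteq> V" "\<And>i. i \<in> I \<Longrightarrow> card (C i) = s i"
    "\<And>i j. i \<in> I \<Longrightarrow> j \<in> I \<Longrightarrow> i \<noteq> j \<Longrightarrow> C i \<inter> C j = {}"
proof -
  have "\<exists>C. (\<forall>i\<in>I. C i \<subseteq> V \<and> card (C i) = s i) \<and> (\<forall>i\<in>I. \<forall>j\<in>I. i \<noteq> j \<longrightarrow> C i \<inter> C j = {})"
    using assms(1,3)
  proof (induction I rule: finite_induct)
    case (insert i I)
    then obtain C where C: "\<forall>i\<in>I. C i \<subseteq> V \<and> card (C i) = s i" "\<forall>i\<in>I. \<forall>j\<in>I. i \<noteq> j \<longrightarrow> C i \<inter> C j = {}"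
      by auto
    define U where "U = (\<Union>i\<in>I. C i)"
    have "card U \<le> (\<Sum>i\<in>I. card (C i))" unfolding U_def by (rule card_UN_le[OF insert(1)])
    also have "\<dots> = (\<Sum>i\<in>I. s i)" using C by (intro sum.cong) auto
    finally have "card U + s i \<le> card V" using insert by simp
    moreover have "card V \<le> card (V - U) + card U"
    proof -
      have "U \<subseteq> V" using C by (auto simp: U_def)
      then have "finite U" using assms(2) finite_subset by blast
      then show ?thesis using diff_card_le_card_Diff[of U V] by linarith
    qed
    ultimately have "s i \<le> card (V - U)" by linarith
    then obtain Z where Z: "Z \<subseteq> V - U" "card Z = s i" by (meson obtain_subset_with_card_n)
    have ZC: "Z \<inter> C j = {}" "C j \<inter> Z = {}" if "j \<in> I" for j using that Z by (auto simp: U_def)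
    show ?case
    proof (intro exI[of _ "C(i := Z)"] conjI ballI impI)
      fix j assume "j \<in> insert i I"
      then show "(C(i := Z)) j \<subseteq> V" "card ((C(i := Z)) j) = s j" using C Z by auto
    next
      fix j j' assume "j \<in> insert i I" "j' \<in> insert i I" "j \<noteq> j'"
      then show "(C(i := Z)) j \<inter> (C(i := Z)) j' = {}" using C(2) ZC by auto
    qed
  qed simp
  then obtain C where "\<forall>i\<in>I. C i \<subseteq> V \<and> card (C i) = s i" "\<forall>i\<in>I. \<forall>j\<in>I. i \<noteq> j \<longrightarrow> C i \<inter> C j = {}"
    by (elim exE conjE)
  then show ?thesis by (intro that[of C]) simp_all
qed

text \<open>Taking \<open>2 t + 1\<close> random blocks is what makes the extra weight \<open>t\<close> on the last family affordable.\<close>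

lemma nested_cross_dependent:
  fixes \<G> :: "nat \<Rightarrow> 'a set set"
  assumes Y: "finite Y" "(2 * t + 1) * b \<le> card Y"
    and G: "\<And>l. l \<in> {1..t + 1} \<Longrightarrow> \<G> l \<subseteq> nsets Y b"
    and nested: "\<And>l l'. 1 \<le> l \<Longrightarrow> l \<le> l' \<Longrightarrow> l' \<le> t + 1 \<Longrightarrow> \<G> l' \<subseteq> \<G> l"
    and free: "\<not> (\<exists>f. (\<forall>l\<in>{1..t + 1}. f l \<in> \<G> l) \<and>
                  (\<forall>l\<in>{1..t + 1}. \<forall>l'\<in>{1..t + 1}. l \<noteq> l' \<longrightarrow> f l \<inter> f l' = {}))"
  shows "(\<Sum>l=1..t + 1. set_density Y b (\<G> l)) + real t * set_density Y b (\<G> (t + 1)) \<le> real t"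
proof -
  define I where "I = {..<2 * t + 1}"
  obtain C where C: "\<And>i. i \<in> I \<Longrightarrow> C i \<subseteq> Y" "\<And>i. i \<in> I \<Longrightarrow> card (C i) = b"
    "\<And>i j. i \<in> I \<Longrightarrow> j \<in> I \<Longrightarrow> i \<noteq> j \<Longrightarrow> C i \<inter> C j = {}"
    using ex_disjoint_blocks[of I Y "\<lambda>_. b"] Y by (auto simp: I_def)
  have pw: "(\<Sum>i\<in>I. (\<Sum>l=1..t + 1. of_bool (\<pi> ` C i \<in> \<G> l)) + real t * of_bool (\<pi> ` C i \<in> \<G> (t + 1)))
      \<le> real (t * (2 * t + 1))" if \<pi>: "\<pi> permutes Y" for \<pi>
  proof -
    define v where "v i = card {l \<in> {1..t + 1}. \<pi> ` C i \<in> \<G> l}" for i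
    \<comment> \<open>By nesting, the families containing a block form an initial segment, so its
      length \<open>v i\<close> records all memberships.\<close>
    have v: "l \<le> v i \<longleftrightarrow> \<pi> ` C i \<in> \<G> l" if l: "l \<in> {1..t + 1}" for i l
    proof
      assume "\<pi> ` C i \<in> \<G> l"
      moreover have "\<G> l \<subseteq> \<G> l'" if "l' \<in> {1..l}" for l' using nested[of l' l] l that by auto
      ultimately have "{1..l} \<subseteq> {l \<in> {1..t + 1}. \<pi> ` C i \<in> \<G> l}" using l by fastforce
      then have "card {1..l} \<le> v i" unfolding v_def by (intro card_mono) auto
      then show "l \<le> v i" by simp
    next
      assume lv: "l \<le> v i"
      show "\<pi> ` C i \<in> \<G> l"
      proof (rule ccontr)
        assume no: "\<pi> ` C i \<notin> \<G> l"
        have "{l \<in> {1..t + 1}. \<pi> ` C i \<in> \<G> l} \<subseteq> {1..<l}"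
        proof (clarsimp, rule ccontr)
          fix l' assume "Suc 0 \<le> l'" "l' \<le> Suc t" "\<pi> ` C i \<in> \<G> l'" "\<not> l' < l"
          then show False using nested[of l l'] l no by auto
        qed
        then have "v i \<le> card {1..<l}" unfolding v_def by (intro card_mono) auto
        then show False using lv l by auto
      qed
    qed
    have vle: "v i \<le> t + 1" for i
      unfolding v_def by (rule order_trans[OF card_mono[of "{1..t + 1}"]]) auto
    then have vle': "v i \<le> Suc t" for i by simp
    have inj: "inj \<pi>" using \<pi> by (rule permutes_inj)
    have "(\<Sum>i\<in>I. v i) + t * card {i \<in> I. v i = t + 1} \<le> t * (2 * t + 1)"
    proof (rule nested_columns_bound)
      show "\<not> (\<exists>f. inj_on f {1..t + 1} \<and> (\<forall>l\<in>{1..t + 1}. f l \<in> I \<and> l \<le> v (f l)))"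
      proof
        assume "\<exists>f. inj_on f {1..t + 1} \<and> (\<forall>l\<in>{1..t + 1}. f l \<in> I \<and> l \<le> v (f l))"
        then obtain f where f: "inj_on f {1..t + 1}" "\<And>l. l \<in> {1..t + 1} \<Longrightarrow> f l \<in> I \<and> l \<le> v (f l)" by blast
        have f1: "\<pi> ` C (f l) \<in> \<G> l" if "l \<in> {1..t + 1}" for l using f(2)[OF that] v[OF that] by simp
        have f2: "\<pi> ` C (f l) \<inter> \<pi> ` C (f l') = {}" if "l \<in> {1..t + 1}" "l' \<in> {1..t + 1}" "l \<noteq> l'" for l l'
        proof -
          have "f l \<noteq> f l'" using f(1) that by (meson inj_onD)
          then have "C (f l) \<inter> C (f l') = {}" using C(3) f(2)[OF that(1)] f(2)[OF that(2)] by simp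
          then show ?thesis using image_Int[OF inj, of "C (f l)" "C (f l')"] by simp
        qed
        have "\<exists>f. (\<forall>l\<in>{1..t + 1}. f l \<in> \<G> l) \<and>
            (\<forall>l\<in>{1..t + 1}. \<forall>l'\<in>{1..t + 1}. l \<noteq> l' \<longrightarrow> f l \<inter> f l' = {})"
          by (rule exI[of _ "\<lambda>l. \<pi> ` C (f l)"], intro conjI ballI impI f1 f2)
        with free show False by contradiction
      qed
    qed (simp_all add: I_def vle')
    then have "real (\<Sum>i\<in>I. v i) + real t * real (card {i \<in> I. v i = t + 1}) \<le> real (t * (2 * t + 1))"
      by (simp only: of_nat_le_iff flip: of_nat_mult of_nat_add)
    moreover have "(\<Sum>l=1..t + 1. of_bool (\<pi> ` C i \<in> \<G> l)) = real (v i)" for i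
      unfolding v_def by (rule card_filter_of_bool[symmetric]) simp
    moreover have "(\<Sum>i\<in>I. of_bool (\<pi> ` C i \<in> \<G> (t + 1))) = real (card {i \<in> I. v i = t + 1})"
    proof -
      have "v i = t + 1 \<longleftrightarrow> \<pi> ` C i \<in> \<G> (t + 1)" for i using v[of "t + 1" i] vle[of i] by auto
      moreover have "finite I" by (simp add: I_def)
      ultimately show ?thesis using card_filter_of_bool[of I "\<lambda>i. v i = t + 1"] by (simp only:)
    qed
    ultimately show ?thesis
      by (simp only: sum.distrib sum_distrib_left[symmetric] of_nat_sum)
  qed
  have avg: "perm_avg Y (\<lambda>\<pi>. of_bool (\<pi> ` C i \<in> \<G> l)) = set_density Y b (\<G> l)" if "i \<in> I" "l \<in> {1..t + 1}" for i l
    using perm_avg_single[OF Y(1) C(1)[OF that(1)], of "\<G> l"] C(2)[OF that(1)] G[OF that(2)] by simp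
  have "perm_avg Y (\<lambda>\<pi>. \<Sum>i\<in>I. (\<Sum>l=1..t + 1. of_bool (\<pi> ` C i \<in> \<G> l)) + real t * of_bool (\<pi> ` C i \<in> \<G> (t + 1)))
      \<le> perm_avg Y (\<lambda>_. real (t * (2 * t + 1)))"
    by (rule perm_avg_mono) (rule pw)
  also have "\<dots> = real (t * (2 * t + 1))" by (rule perm_avg_const[OF Y(1)])
  also have "perm_avg Y (\<lambda>\<pi>. \<Sum>i\<in>I. (\<Sum>l=1..t + 1. of_bool (\<pi> ` C i \<in> \<G> l)) + real t * of_bool (\<pi> ` C i \<in> \<G> (t + 1)))
      = (\<Sum>i\<in>I. (\<Sum>l=1..t + 1. set_density Y b (\<G> l)) + real t * set_density Y b (\<G> (t + 1)))"
    unfolding perm_avg_sum perm_avg_add perm_avg_mult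
    by (intro sum.cong arg_cong2[of _ _ _ _ "(+)"] arg_cong2[of _ _ _ _ "(*)"] refl avg) auto
  also have "\<dots> = real (2 * t + 1) * ((\<Sum>l=1..t + 1. set_density Y b (\<G> l)) + real t * set_density Y b (\<G> (t + 1)))"
    unfolding sum_constant by (simp add: I_def)
  finally have "real (2 * t + 1) * ((\<Sum>l=1..t + 1. set_density Y b (\<G> l)) + real t * set_density Y b (\<G> (t + 1)))
      \<le> real (2 * t + 1) * real t" by (simp only: of_nat_mult mult.commute[of "real t"])
  moreover have "0 < real (2 * t + 1)" by simp
  ultimately show ?thesis by (simp only: mult_le_cancel_left_pos)
qed

text \<open>A set \<open>S\<close> lies inside \<open>R\<close> exactly when it misses
  \<open>Y - R\<close>. So no member of \<open>\<G>\<close> is disjoint from the complement of a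
  \<open>b\<close>-set outside the upper shadow, and mixing with pair count zero forces one of the
  two families to be small.\<close>

lemma upshadow_expansion:
  assumes Y: "finite Y" and ab: "a < b" "b \<le> card Y" and G: "\<G> \<subseteq> nsets Y a"
  defines "\<gamma> \<equiv> set_density Y a \<G>" and "\<gamma>' \<equiv> set_density Y b {R \<in> nsets Y b. \<exists>S\<in>\<G>. S \<subseteq> R}"
  shows "\<gamma> \<le> \<gamma>' * (\<gamma> + real a / real b * (1 - \<gamma>))"
proof -
  define \<H> where "\<H> = (\<lambda>R. Y - R) ` {R \<in> nsets Y b. \<not> (\<exists>S\<in>\<G>. S \<subseteq> R)}"
  let ?U = "{R \<in> nsets Y b. \<exists>S\<in>\<G>. S \<subseteq> R}" and ?L = "{R \<in> nsets Y b. \<not> (\<exists>S\<in>\<G>. S \<subseteq> R)}"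
  define N where "N = card Y"
  have H: "\<H> \<subseteq> nsets Y (N - b)"
    using Y by (auto simp: \<H>_def nsets_def card_Diff_subset N_def)
  have fin: "finite ?U" "finite ?L" using finite_imp_finite_nsets[OF Y] by auto
  have "card \<H> = card ?L" unfolding \<H>_def
    by (rule card_image) (auto simp: inj_on_def nsets_def)
  moreover have "card ?U + card ?L = N choose b"
  proof -
    have "card (?U \<union> ?L) = card ?U + card ?L" using fin by (intro card_Un_disjoint) auto
    moreover have "?U \<union> ?L = nsets Y b" by auto
    ultimately show ?thesis using Y by (simp add: card_nsets N_def)
  qed
  ultimately have cH: "real (card \<H>) = real (N choose b) - real (card ?U)" by linarith
  have sym: "N choose (N - b) = N choose b" using binomial_symmetric[of b N] ab by (simp add: N_def)
  have pos: "real (N choose b) > 0" using ab by (simp add: N_def)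
  have \<psi>: "set_density Y (N - b) \<H> = 1 - \<gamma>'"
    unfolding set_density_def \<gamma>'_def N_def[symmetric] sym cH using pos by (simp add: diff_divide_distrib)
  have emp: "{(S, z). S \<in> \<G> \<and> z \<in> \<H> \<and> S \<inter> z = {}} = {}"
  proof -
    have False if "S \<in> \<G>" "R \<in> ?L" "S \<inter> (Y - R) = {}" for S R
    proof -
      have "S \<subseteq> Y" using that G by (auto simp: nsets_def)
      then show False using that by blast
    qed
    then show ?thesis unfolding \<H>_def by blast
  qed
  have "(0 - \<gamma> * (1 - \<gamma>'))\<^sup>2 \<le> (real a * real (N - b) / (real (N - a) * real (N - (N - b))))
      * (\<gamma> * (1 - \<gamma>)) * ((1 - \<gamma>') * (1 - (1 - \<gamma>')))"
    using disjointness_mixing[OF Y _ _ _ G H] ab unfolding emp N_def[symmetric] \<psi> \<gamma>_def[symmetric] by simp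
  also have "\<dots> \<le> real a / real b * (\<gamma> * (1 - \<gamma>)) * ((1 - \<gamma>') * \<gamma>')"
  proof -
    have "real a * real (N - b) / (real (N - a) * real (N - (N - b))) = real a / real b * (real (N - b) / real (N - a))"
      using ab by (simp add: N_def mult.commute)
    also have "\<dots> \<le> real a / real b * 1"
      using ab by (intro mult_left_mono) (auto simp: N_def)
    finally have "real a * real (N - b) / (real (N - a) * real (N - (N - b))) \<le> real a / real b" by simp
    moreover have "0 \<le> \<gamma>" "\<gamma> \<le> 1" "0 \<le> \<gamma>'" "\<gamma>' \<le> 1"
      using set_density_le_1[OF Y G] set_density_le_1[OF Y, of ?U b] by (auto simp: \<gamma>_def \<gamma>'_def set_density_nonneg)
    ultimately show ?thesis by (intro mult_mono) auto
  qed
  finally have main: "(\<gamma> * (1 - \<gamma>')) * (\<gamma> * (1 - \<gamma>')) \<le> (\<gamma> * (1 - \<gamma>')) * (real a / real b * (1 - \<gamma>) * \<gamma>')"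
    by (simp add: power2_eq_square mult_ac)
  have rng: "0 \<le> \<gamma>" "\<gamma> \<le> 1" "0 \<le> \<gamma>'" "\<gamma>' \<le> 1"
    using set_density_le_1[OF Y G] set_density_le_1[OF Y, of ?U b] by (auto simp: \<gamma>_def \<gamma>'_def set_density_nonneg)
  show ?thesis
  proof (cases "\<gamma> * (1 - \<gamma>') = 0")
    case True
    then show ?thesis using rng by auto
  next
    case False
    then have "0 < \<gamma> * (1 - \<gamma>')" using rng by (simp add: less_le)
    then have "\<gamma> * (1 - \<gamma>') \<le> real a / real b * (1 - \<gamma>) * \<gamma>'"
      using main by (meson mult_le_cancel_left_pos)
    then show ?thesis by (simp add: algebra_simps)
  qed
qed

section \<open>Stars and families close to them\<close>

lemma finite_star: "finite (star_family n k T)"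
  unfolding star_family_def using finite_imp_finite_nsets[of "{1..n}" k] by simp

lemma card_star:
  assumes "T \<in> nsets {1..n} t"
  shows "real (card (star_family n k T)) = real (n choose k) - real ((n - t) choose k)"
proof -
  have T: "finite T" "T \<subseteq> {1..n}" "card T = t" using assms by (auto simp: nsets_def)
  have "nsets {1..n} k = star_family n k T \<union> nsets ({1..n} - T) k"
    by (auto simp: star_family_def nsets_diff)
  moreover have "star_family n k T \<inter> nsets ({1..n} - T) k = {}"
    by (auto simp: star_family_def nsets_diff)
  ultimately have "card (nsets {1..n} k) = card (star_family n k T) + card (nsets ({1..n} - T) k)"
    using finite_star finite_imp_finite_nsets[of "{1..n} - T" k] by (simp add: card_Un_disjoint)
  moreover have "card ({1..n} - T) = n - t" using T by (simp add: card_Diff_subset)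
  ultimately have "n choose k = card (star_family n k T) + ((n - t) choose k)"
    by (simp add: card_nsets)
  then show ?thesis by simp
qed

text \<open>The pair of \<open>l\<close> and \<open>E\<close> can be recovered from
  \<open>insert l E\<close>, because \<open>E\<close> avoids \<open>L\<close>; no missing set is
  counted twice.\<close>

lemma sum_missing_links_le:
  assumes L: "finite L" "L \<subseteq> T" and V: "finite V" "V \<inter> L = {}"
    and M: "\<And>l. l \<in> L \<Longrightarrow> M l \<subseteq> nsets V (k - 1)"
    and "finite \<X>" and X: "\<And>l E. l \<in> L \<Longrightarrow> E \<in> M l \<Longrightarrow> insert l E \<in> \<X>"
  shows "(\<Sum>l\<in>L. card (M l)) \<le> card \<X>"
proof -
  have fin: "finite (M l)" if "l \<in> L" for l using M[OF that] finite_imp_finite_nsets[OF V(1)] by (rule finite_subset)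
  have E: "E \<inter> L = {}" if "l \<in> L" "E \<in> M l" for l E using M[OF that(1)] that(2) V by (auto simp: nsets_def)
  have "(\<Sum>l\<in>L. card (M l)) = card (SIGMA l:L. M l)" using L fin by simp
  also have "\<dots> = card ((\<lambda>(l, E). insert l E) ` (SIGMA l:L. M l))"
  proof (rule card_image[symmetric], rule inj_onI, clarify)
    fix l E l' E' assume a: "l \<in> L" "E \<in> M l" "l' \<in> L" "E' \<in> M l'" "insert l E = insert l' E'"
    have "l = l'" using a E[of l E] E[of l' E'] by blast
    moreover have "l \<notin> E" "l \<notin> E'" using a E by blast+
    ultimately show "l = l' \<and> E = E'" using a insert_ident by metis
  qed
  also have "\<dots> \<le> card \<X>" using X by (intro card_mono assms) auto
  finally show ?thesis .
qed

text \<open>A set of \<open>B\<close> together with disjoint link sets, one for each point of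
  \<open>T\<close>, would give a matching of size \<open>t + 1\<close>. So whenever a random
  \<open>k\<close>-block lands in \<open>B\<close>, one of the \<open>t\<close> link blocks lands in
  some \<open>M i\<close>; mixing bounds the probability of each such coincidence.\<close>

lemma star_bootstrap:
  assumes A: "\<A> \<subseteq> nsets {1..n} k" and nm: "\<not> (\<exists>M. matching_in \<A> (t + 1) M)"
    and T: "T \<in> nsets {1..n} t" and tk: "0 < t" "0 < k" and n: "(2 * t + 1) * k + t \<le> n"
    and small: "10 * card (star_family n k T - \<A>) \<le> (n - t - 1) choose (k - 1)"
  shows "3 * card (\<A> - star_family n k T) \<le> 2 * card (star_family n k T - \<A>)"
proof -
  define V where "V = {1..n} - T"
  define N where "N = n - t"
  have T': "finite T" "T \<subseteq> {1..n}" "card T = t" using T by (auto simp: nsets_def)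
  have V: "finite V" "card V = N" using T' by (auto simp: V_def N_def card_Diff_subset)
  have N: "(2 * t + 1) * k \<le> N" using n by (simp add: N_def)
  then have N2: "2 * t * k + k \<le> N" by (simp add: algebra_simps)
  have "1 * 1 \<le> t * k" using tk by (intro mult_le_mono) auto
  then have kN: "k < N" using N2 by linarith
  define B where "B = \<A> - star_family n k T"
  define M where "M i = {E \<in> nsets V (k - 1). insert i E \<notin> \<A>}" for i
  define m where "m = card (star_family n k T - \<A>)"
  have B: "B \<subseteq> nsets V k" using A unfolding B_def V_def star_family_def nsets_diff by blast
  have M: "M i \<subseteq> nsets V (k - 1)" for i by (auto simp: M_def)
  have insV: "insert i E \<in> nsets {1..n} k" "i \<notin> E" if "i \<in> T" "E \<in> nsets V (k - 1)" for i E
  proof -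
    show "i \<notin> E" using that by (auto simp: nsets_def V_def)
    then show "insert i E \<in> nsets {1..n} k" using that T' tk by (auto simp: nsets_def V_def)
  qed
  have sumM: "(\<Sum>i\<in>T. card (M i)) \<le> m" unfolding m_def
  proof (rule sum_missing_links_le[OF T'(1) order_refl V(1)])
    show "insert i E \<in> star_family n k T - \<A>" if "i \<in> T" "E \<in> M i" for i E
      using that insV by (auto simp: M_def star_family_def)
  qed (use M finite_star in \<open>auto simp: V_def\<close>)
  \<comment> \<open>The label 0 is free because \<open>T\<close> consists of positive numbers; it
    marks the block meant for \<open>B\<close>.\<close>
  define s where "s i = (if i = 0 then k else k - 1)" for i :: nat
  have z: "0 \<notin> T" using T' by auto
  have "(\<Sum>i\<in>insert 0 T. s i) = k + t * (k - 1)"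
  proof -
    have "(\<Sum>i\<in>T. s i) = (\<Sum>i\<in>T. k - 1)" using z by (intro sum.cong) (auto simp: s_def)
    then show ?thesis using T' z by (simp add: s_def)
  qed
  also have "\<dots> \<le> k + t * k" by simp
  also have "\<dots> \<le> card V" using N2 V(2) by linarith
  finally obtain C where C: "\<And>i. i \<in> insert 0 T \<Longrightarrow> C i \<subseteq> V" "\<And>i. i \<in> insert 0 T \<Longrightarrow> card (C i) = s i"
    "\<And>i j. i \<in> insert 0 T \<Longrightarrow> j \<in> insert 0 T \<Longrightarrow> i \<noteq> j \<Longrightarrow> C i \<inter> C j = {}"
    using ex_disjoint_blocks[of "insert 0 T" V s] T'(1) V(1) by auto
  have cC: "card (C 0) = k" "\<And>i. i \<in> T \<Longrightarrow> card (C i) = k - 1"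
    using C(2) z by (auto simp: s_def)
  have pw: "of_bool (\<pi> ` C 0 \<in> B) \<le> (\<Sum>i\<in>T. of_bool (\<pi> ` C 0 \<in> B \<and> \<pi> ` C i \<in> M i) :: real)"
    if \<pi>: "\<pi> permutes V" for \<pi>
  proof (cases "\<pi> ` C 0 \<in> B \<and> (\<forall>i\<in>T. \<pi> ` C i \<notin> M i)")
    case True
    have inj: "inj \<pi>" using \<pi> by (rule permutes_inj)
    define g where "g i = (if i = 0 then \<pi> ` C 0 else insert i (\<pi> ` C i))" for i
    have im: "\<pi> ` C i \<in> nsets V (card (C i))" if "i \<in> insert 0 T" for i
      using perm_image_nsets[OF \<pi> V(1) C(1)[OF that]] .
    have imV: "\<pi> ` C i \<subseteq> V" if "i \<in> insert 0 T" for i using im[OF that] by (auto simp: nsets_def)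
    have dis: "\<pi> ` C i \<inter> \<pi> ` C j = {}" if "i \<in> insert 0 T" "j \<in> insert 0 T" "i \<noteq> j" for i j
      using C(3)[OF that] image_Int[OF inj, of "C i" "C j"] by simp
    have gA: "g i \<in> \<A>" if "i \<in> insert 0 T" for i
    proof (cases "i = 0")
      case True
      then show ?thesis using \<open>\<pi> ` C 0 \<in> B \<and> _\<close> by (auto simp: g_def B_def)
    next
      case False
      then have "i \<in> T" using that by simp
      then have "\<pi> ` C i \<in> nsets V (k - 1)" "\<pi> ` C i \<notin> M i" using im[OF that] cC(2) True by auto
      then show ?thesis using False by (auto simp: M_def g_def)
    qed
    have "matching_in \<A> (card (insert 0 T)) (g ` insert 0 T)"
    proof (rule matching_in_indexed)
      show "g i \<noteq> {}" if "i \<in> insert 0 T" for i using gA[OF that] A tk by (auto simp: nsets_def)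
      show "g i \<inter> g j = {}" if "i \<in> insert 0 T" "j \<in> insert 0 T" "i \<noteq> j" for i j
      proof -
        have "i \<notin> V \<or> i = 0" "j \<notin> V \<or> j = 0" using that by (auto simp: V_def)
        then have "i = 0 \<or> i \<notin> \<pi> ` C j" "j = 0 \<or> j \<notin> \<pi> ` C i"
          using imV[OF that(1)] imV[OF that(2)] by (meson subsetD)+
        then show ?thesis using dis[OF that] that(3) by (auto simp: g_def)
      qed
    qed (use gA T' in auto)
    then show ?thesis using nm T' z by simp
  next
    case False
    show ?thesis
    proof (cases "\<pi> ` C 0 \<in> B")
      case True
      then obtain i where i: "i \<in> T" "\<pi> ` C i \<in> M i" using False by blast
      have "(1::real) = of_bool (\<pi> ` C 0 \<in> B \<and> \<pi> ` C i \<in> M i)" using True i by simp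
      also have "\<dots> \<le> (\<Sum>i\<in>T. of_bool (\<pi> ` C 0 \<in> B \<and> \<pi> ` C i \<in> M i))"
        using i(1) T'(1) by (intro member_le_sum) auto
      finally show ?thesis using True by simp
    qed (simp add: sum_nonneg)
  qed
  define \<beta> where "\<beta> = set_density V k B"
  define \<mu> where "\<mu> i = set_density V (k - 1) (M i)" for i
  define \<kappa> where "\<kappa> = real k * real (k - 1) / (real (N - k) * real (N - (k - 1)))"
  have \<beta>: "0 \<le> \<beta>" "\<beta> \<le> 1" using set_density_nonneg set_density_le_1[OF V(1) B] by (auto simp: \<beta>_def)
  have \<mu>: "0 \<le> \<mu> i" "\<mu> i \<le> 1" for i using set_density_nonneg set_density_le_1[OF V(1) M] by (auto simp: \<mu>_def)
  have \<kappa>: "0 \<le> \<kappa>" by (simp add: \<kappa>_def)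
  \<comment> \<open>The mixing error, the square root of
    \<open>\<kappa> * \<beta> * \<mu> i\<close>, is split by the arithmetic-geometric mean
    inequality. The weight \<open>t\<close> is chosen so that the terms \<open>\<beta> / t\<close>
    add up to \<open>\<beta>\<close>, half of which is absorbed on the left.\<close>
  have P: "perm_avg V (\<lambda>\<pi>. of_bool (\<pi> ` C 0 \<in> B \<and> \<pi> ` C i \<in> M i)) \<le> \<beta> * \<mu> i + (\<beta> / t + t * \<kappa> * \<mu> i) / 2"
    if i: "i \<in> T" for i
  proof -
    define p where "p = perm_avg V (\<lambda>\<pi>. of_bool (\<pi> ` C 0 \<in> B \<and> \<pi> ` C i \<in> M i))"
    have "(p - \<beta> * \<mu> i)\<^sup>2 \<le> \<kappa> * (\<beta> * (1 - \<beta>)) * (\<mu> i * (1 - \<mu> i))"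
      unfolding p_def \<beta>_def \<mu>_def \<kappa>_def V(2)[symmetric]
    proof (rule perm_avg_mixing[OF V(1)])
      show "C 0 \<subseteq> V" "C i \<subseteq> V" using C(1) i by auto
      show "C 0 \<inter> C i = {}" using C(3)[of 0 i] i z by auto
      show "k < card V" "k - 1 < card V" using kN V(2) by auto
    qed (use cC i B M in auto)
    also have "\<dots> \<le> \<kappa> * (\<beta> * 1) * (\<mu> i * 1)"
      using \<beta> \<mu>[of i] \<kappa> by (intro mult_mono) auto
    also have "\<dots> \<le> ((\<beta> / t + t * \<kappa> * \<mu> i) / 2)\<^sup>2"
    proof -
      have "0 \<le> ((\<beta> / t - t * \<kappa> * \<mu> i) / 2)\<^sup>2" by simp
      also have "\<dots> = ((\<beta> / t + t * \<kappa> * \<mu> i) / 2)\<^sup>2 - (\<beta> / t) * (t * \<kappa> * \<mu> i)"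
        by (simp add: power2_eq_square field_simps)
      also have "(\<beta> / t) * (t * \<kappa> * \<mu> i) = \<kappa> * (\<beta> * 1) * (\<mu> i * 1)" using tk by simp
      finally show ?thesis by simp
    qed
    finally have "p - \<beta> * \<mu> i \<le> (\<beta> / t + t * \<kappa> * \<mu> i) / 2"
      by (rule power2_le_imp_le) (use \<beta> \<mu> \<kappa> in simp)
    then show ?thesis unfolding p_def by linarith
  qed
  define S where "S = (\<Sum>i\<in>T. \<mu> i)"
  define D where "D = real (N choose (k - 1))"
  have D: "D > 0" using kN by (simp add: D_def)
  have S: "S * D \<le> real m" "0 \<le> S"
  proof -
    have "S * D = real (\<Sum>i\<in>T. card (M i))"
      using D unfolding S_def \<mu>_def set_density_def V(2) D_def[symmetric] by (simp add: sum_distrib_right)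
    then show "S * D \<le> real m" using sumM by linarith
  qed (simp add: S_def \<mu> sum_nonneg)
  have "S \<le> 1 / 10"
  proof -
    have "(n - t - 1) choose (k - 1) \<le> N choose (k - 1)" unfolding N_def by (intro binomial_right_mono) simp
    then have "10 * real m \<le> D" using small by (simp add: D_def m_def)
    then have "10 * S * D \<le> 1 * D" using S by linarith
    then have "10 * S \<le> 1" using D by (simp only: mult_le_cancel_right_pos)
    then show ?thesis by simp
  qed
  have "\<beta> = perm_avg V (\<lambda>\<pi>. of_bool (\<pi> ` C 0 \<in> B))"
    using perm_avg_single[OF V(1) C(1), of 0 B] B cC by (simp add: \<beta>_def)
  also have "\<dots> \<le> (\<Sum>i\<in>T. perm_avg V (\<lambda>\<pi>. of_bool (\<pi> ` C 0 \<in> B \<and> \<pi> ` C i \<in> M i)))"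
    unfolding perm_avg_sum[symmetric] by (rule perm_avg_mono) (rule pw)
  also have "\<dots> \<le> (\<Sum>i\<in>T. \<beta> * \<mu> i + (\<beta> / t + t * \<kappa> * \<mu> i) / 2)" by (rule sum_mono) (rule P)
  also have "\<dots> = \<beta> * S + \<beta> / 2 + t * \<kappa> * S / 2"
    using tk T' by (simp add: S_def sum.distrib sum_distrib_left add_divide_distrib sum_divide_distrib)
  finally have "\<beta> * (1 / 2 - S) \<le> t * \<kappa> * S / 2" by (simp add: algebra_simps)
  moreover have "\<beta> * (2 / 5) \<le> \<beta> * (1 / 2 - S)" using \<beta> \<open>S \<le> 1 / 10\<close> by (intro mult_left_mono) auto
  ultimately have \<beta>S: "\<beta> \<le> 5 / 4 * t * \<kappa> * S" by simp
  define x where "x = real (N - k)"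
  have x: "x > 0" "2 * real t * real k \<le> x" "real (N - (k - 1)) = x + 1"
  proof -
    have d: "x = real N - real k" "real (N - (k - 1)) = real N - (real k - 1)"
      using kN tk by (auto simp: x_def of_nat_diff)
    have "real (2 * t * k + k) \<le> real N" using N2 by (simp only: of_nat_le_iff)
    then show "2 * real t * real k \<le> x" using d by simp
    show "x > 0" "real (N - (k - 1)) = x + 1" using d kN by auto
  qed
  \<comment> \<open>Passing from densities to cardinalities costs a factor
    \<open>(x + 1) / k\<close>, which cancels against \<open>\<kappa>\<close>. The remaining
    \<open>t * (k - 1) / x\<close> is at most 1/2 by the bound on \<open>n\<close>, and the final
    constant 5/8 is below 2/3.\<close>
  have absorb: "real (N choose k) * real k = D * (x + 1)"
  proof -
    have "Suc (k - 1) * (N choose Suc (k - 1)) = (N - (k - 1)) * (N choose (k - 1))"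
      unfolding binomial_absorption binomial_absorb_comp ..
    then have "k * (N choose k) = (N - (k - 1)) * (N choose (k - 1))" using tk by simp
    then show ?thesis unfolding D_def x(3)[symmetric] by (metis mult.commute of_nat_mult)
  qed
  have cB: "real (card B) = \<beta> * real (N choose k)"
    using kN by (simp add: \<beta>_def set_density_def V(2))
  have "real (card B) * real k = \<beta> * (D * (x + 1))" unfolding cB absorb[symmetric] by simp
  also have "\<dots> \<le> (5 / 4 * t * \<kappa> * S) * (D * (x + 1))"
    using \<beta>S D x by (intro mult_right_mono) auto
  also have "\<dots> = 5 / 4 * t * real k * real (k - 1) / x * (S * D)"
    using x by (simp add: \<kappa>_def x(3) x_def[symmetric])
  also have "\<dots> \<le> 5 / 4 * t * real k * real (k - 1) / x * m"
    using S x by (intro mult_left_mono) auto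
  also have "\<dots> \<le> 5 / 8 * real k * m"
  proof -
    have "2 * (real t * real (k - 1)) \<le> 2 * (real t * real k)" by (intro mult_left_mono) auto
    then have "2 * (real t * real (k - 1)) \<le> x" using x by linarith
    then have "real t * real (k - 1) / x \<le> 1 / 2" using x by (simp add: divide_le_eq)
    then have "5 / 4 * real k * real m * (real t * real (k - 1) / x) \<le> 5 / 4 * real k * real m * (1 / 2)"
      by (intro mult_left_mono) auto
    then show ?thesis by (simp add: mult_ac)
  qed
  finally have "real k * real (card B) \<le> real k * (5 / 8 * m)" by (simp add: mult_ac)
  moreover have "0 < real k" using tk by simp
  ultimately have "real (card B) \<le> 5 / 8 * m" by (simp only: mult_le_cancel_left_pos)
  then have "real (3 * card B) \<le> real (2 * m)" by simp
  then show ?thesis unfolding B_def m_def by linarith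
qed

section \<open>Undoing a shift\<close>

text \<open>If the shift creates a missing set \<open>F\<close> of \<open>\<S>\<close>, it removes
  the version of \<open>F\<close> with \<open>j\<close> in place of \<open>i\<close>. That version
  is again in \<open>\<S>\<close>, so it replaces \<open>F\<close> among the missing sets.\<close>

lemma missing_shift_mono:
  assumes fin: "finite \<S>" and ij: "i \<noteq> j"
    and closed: "\<And>F. F \<in> \<S> \<Longrightarrow> i \<in> F \<Longrightarrow> j \<notin> F \<Longrightarrow> insert j (F - {i}) \<in> \<S>"
  shows "card (\<S> - \<A>) \<le> card (\<S> - shift \<A> i j)"
proof -
  define f where "f F = (if F \<in> shift \<A> i j then insert j (F - {i}) else F)" for F
  have moved: "i \<in> F" "j \<notin> F" "insert j (F - {i}) \<in> \<A>" "insert j (F - {i}) \<notin> shift \<A> i j"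
    if "F \<in> \<S> - \<A>" "F \<in> shift \<A> i j" for F
  proof -
    show 1: "i \<in> F" "j \<notin> F" and 2: "insert j (F - {i}) \<in> \<A>"
      using that mem_shift_iff[OF ij, of F \<A>] by (auto split: if_splits)
    have "insert i (insert j (F - {i}) - {j}) = F" using 1 ij by auto
    then show "insert j (F - {i}) \<notin> shift \<A> i j"
      using mem_shift_iff[OF ij, of "insert j (F - {i})" \<A>] ij that by auto
  qed
  have "inj_on f (\<S> - \<A>)"
  proof (rule inj_onI)
    fix F G assume FG: "F \<in> \<S> - \<A>" "G \<in> \<S> - \<A>" "f F = f G"
    show "F = G"
    proof (cases "F \<in> shift \<A> i j"; cases "G \<in> shift \<A> i j")
      assume s: "F \<in> shift \<A> i j" "G \<in> shift \<A> i j"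
      then have "insert j (F - {i}) = insert j (G - {i})" using FG(3) by (simp add: f_def)
      moreover have "F = insert i (insert j (F - {i}) - {j})" "G = insert i (insert j (G - {i}) - {j})"
        using moved(1,2)[OF FG(1) s(1)] moved(1,2)[OF FG(2) s(2)] ij by auto
      ultimately show ?thesis by simp
    next
      assume s: "F \<in> shift \<A> i j" "G \<notin> shift \<A> i j"
      then show ?thesis using moved(3)[OF FG(1) s(1)] FG by (simp add: f_def)
    next
      assume s: "F \<notin> shift \<A> i j" "G \<in> shift \<A> i j"
      then show ?thesis using moved(3)[OF FG(2) s(2)] FG by (simp add: f_def)
    qed (use FG in \<open>simp add: f_def\<close>)
  qed
  then have "card (\<S> - \<A>) = card (f ` (\<S> - \<A>))" by (rule card_image[symmetric])
  also have "\<dots> \<le> card (\<S> - shift \<A> i j)"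
  proof (rule card_mono)
    show "f ` (\<S> - \<A>) \<subseteq> \<S> - shift \<A> i j"
      using moved closed by (auto simp: f_def)
  qed (use fin in simp)
  finally show ?thesis .
qed

text \<open>When the densities nearly cover everything, \<open>1 - \<gamma>\<close> is about at most
  \<open>h\<close> and vice versa. With \<open>\<kappa> \<le> 1 / 4\<close> the mixing error is then
  only about half of \<open>\<gamma> * h\<close>, so two large links would span many disjoint
  pairs.\<close>

lemma link_dichotomy:
  fixes \<gamma> h P \<kappa> :: real
  assumes mix: "(P - \<gamma> * h)\<^sup>2 \<le> \<kappa> * (\<gamma> * (1 - \<gamma>)) * (h * (1 - h))"
    and P: "P \<le> 1 / 1000" and \<kappa>: "0 \<le> \<kappa>" "\<kappa> \<le> 1 / 4"
    and rng: "0 \<le> \<gamma>" "\<gamma> \<le> 1" "0 \<le> h" "h \<le> 1" and cover: "1 - \<gamma> - h \<le> 1 / 1000"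
  shows "\<gamma> \<le> 1 / 12 \<or> h \<le> 1 / 12"
proof (rule ccontr)
  assume "\<not> ?thesis"
  then have big: "\<gamma> > 1 / 12" "h > 1 / 12" by auto
  have "(\<gamma> * h - P)\<^sup>2 \<le> \<kappa> * (\<gamma> * (1 - \<gamma>)) * (h * (1 - h))" using mix by (simp add: power2_commute)
  \<comment> \<open>As \<open>h > 1 / 12\<close>, the covering error 1/1000 is below
    \<open>3 / 50 * h\<close>, whence \<open>1 - \<gamma> \<le> 53 / 50 * h\<close>; symmetrically
    for \<open>\<gamma>\<close>.\<close>
  also have "\<dots> \<le> 1 / 4 * (\<gamma> * (53 / 50 * h)) * (h * (53 / 50 * \<gamma>))"
    using \<kappa> rng cover big by (intro mult_mono) auto
  also have "\<dots> = (53 / 100 * (\<gamma> * h))\<^sup>2" by (simp add: power2_eq_square)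
  finally have "\<gamma> * h - P \<le> 53 / 100 * (\<gamma> * h)"
    by (rule power2_le_imp_le) (use rng in simp)
  then have "\<gamma> * h \<le> 1 / 470" using P by simp
  moreover have "0 \<le> (\<gamma> - 1 / 12) * (h - 1 / 12)" using big by simp
  then have "\<gamma> * h \<ge> (\<gamma> + h) / 12 - 1 / 144" by (simp add: field_simps)
  moreover have "(\<gamma> + h) / 12 \<ge> 1 / 13" using cover by simp
  ultimately show False by linarith
qed

text \<open>If the star of \<open>T\<close> is closed under replacing \<open>i\<close> by
  \<open>j\<close>, \<open>missing_shift_mono\<close> already suffices. Otherwise the links
  \<open>G\<close> of \<open>i\<close> and \<open>H\<close> of \<open>j\<close> compete: a small
  \<open>H\<close> keeps \<open>T\<close>, a small \<open>G\<close> calls for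
  \<open>T1\<close>.\<close>

lemma shift_dichotomy:
  assumes A: "\<A> \<subseteq> nsets {1..n} k" and nm: "\<not> (\<exists>M. matching_in \<A> (t + 1) M)"
    and T: "T \<in> nsets {1..n} t" and tk: "0 < t" "0 < k" and n: "(2 * t + 1) * k + t \<le> n"
    and ij: "i \<in> {1..n}" "j \<in> {1..n}" "i \<noteq> j"
    and small: "1000 * card (star_family n k T - shift \<A> i j) \<le> (n - t - 1) choose (k - 1)"
  shows "\<exists>T'\<in>nsets {1..n} t. 10 * card (star_family n k T' - \<A>) \<le> (n - t - 1) choose (k - 1)"
proof (cases "i \<in> T \<and> j \<notin> T")
  case False
  have "card (star_family n k T - \<A>) \<le> card (star_family n k T - shift \<A> i j)"
  proof (rule missing_shift_mono[OF finite_star ij(3)])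
    fix F assume F: "F \<in> star_family n k T" "i \<in> F" "j \<notin> F"
    then have "F \<subseteq> {1..n}" "finite F" "card F = k" "F \<inter> T \<noteq> {}" by (auto simp: star_family_def nsets_def)
    moreover have "card (insert j (F - {i})) = card F"
      using F calculation card_Suc_Diff1[of F i] by simp
    moreover have "insert j (F - {i}) \<inter> T \<noteq> {}" using False calculation(4) by auto
    ultimately show "insert j (F - {i}) \<in> star_family n k T"
      using ij by (auto simp: star_family_def nsets_def)
  qed
  then show ?thesis using small T by (intro bexI[of _ T]) auto
next
  case True
  define B where "B = shift \<A> i j"
  define T0 where "T0 = T - {i}"
  define T1 where "T1 = insert j T0"
  define Y where "Y = {1..n} - T - {j}"
  define N where "N = n - t - 1"
  define D where "D = N choose (k - 1)"
  have T': "finite T" "T \<subseteq> {1..n}" "card T = t" using T by (auto simp: nsets_def)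
  have T1: "T1 \<in> nsets {1..n} t"
    using T' True ij card_Suc_Diff1[of T i] by (auto simp: T1_def T0_def nsets_def)
  have Y: "finite Y" "card Y = N"
    using T' True ij by (auto simp: Y_def N_def card_Diff_subset)
  have "2 * (t * k) + k \<le> N + 1" using n by (simp add: N_def algebra_simps)
  moreover have "k \<le> t * k" using tk by simp
  moreover have "(t + 1) * k = t * k + k" by simp
  ultimately have N: "3 * k \<le> N + 1" "(t + 1) * k \<le> N + 1" by linarith+
  have cY: "card (nsets Y (k - 1)) = D" using Y by (simp add: card_nsets D_def)
  have D: "D > 0" using N tk by (simp add: D_def)
  define G where "G = {E \<in> nsets Y (k - 1). insert i E \<in> \<A>}"
  define H where "H = {E \<in> nsets Y (k - 1). insert j E \<in> \<A>}"
  define M where "M l = {E \<in> nsets Y (k - 1). insert l E \<notin> \<A>}" for l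
  have sub: "G \<subseteq> nsets Y (k - 1)" "H \<subseteq> nsets Y (k - 1)" "M l \<subseteq> nsets Y (k - 1)" for l
    by (auto simp: G_def H_def M_def)
  have finY: "finite (nsets Y (k - 1))" by (rule finite_imp_finite_nsets[OF Y(1)])
  have out: "l \<notin> E" "insert l E \<in> nsets {1..n} k" if "l \<in> insert j T" "E \<in> nsets Y (k - 1)" for l E
  proof -
    show "l \<notin> E" using that by (auto simp: nsets_def Y_def)
    then show "insert l E \<in> nsets {1..n} k" using that T' ij tk by (auto simp: nsets_def Y_def)
  qed
  define m where "m = card (star_family n k T - B)"
  have m: "1000 * m \<le> D" using small by (simp add: m_def B_def D_def N_def)
  have finm: "finite (star_family n k T - B)" using finite_star by simp
  \<comment> \<open>If \<open>E\<close> is in neither link, the shift cannot create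
    \<open>insert i E\<close>, so every member of \<open>R\<close> accounts for a set missing from
    the shifted family.\<close>
  define R where "R = nsets Y (k - 1) - (G \<union> H)"
  have cR: "card R \<le> m"
  proof -
    have "card R = card (insert i ` R)"
    proof (rule card_image[symmetric], rule inj_onI)
      fix E E' assume "E \<in> R" "E' \<in> R" "insert i E = insert i E'"
      moreover then have "i \<notin> E" "i \<notin> E'" using out(1)[of i] True by (auto simp: R_def)
      ultimately show "E = E'" by (simp add: insert_ident)
    qed
    also have "\<dots> \<le> m" unfolding m_def
    proof (rule card_mono[OF finm], clarify)
      fix E assume E: "E \<in> R"
      then have E': "E \<in> nsets Y (k - 1)" "E \<notin> G" "E \<notin> H" by (auto simp: R_def)
      have o: "i \<notin> E" "j \<notin> E" "insert i E \<in> nsets {1..n} k" using out[OF _ E'(1)] True by auto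
      have "insert i E \<notin> \<A>" "insert j (insert i E - {i}) \<notin> \<A>" using E' o by (auto simp: G_def H_def)
      then have "insert i E \<notin> B" unfolding B_def using mem_shift_iff[OF ij(3), of "insert i E" \<A>] o ij by auto
      then show "insert i E \<in> star_family n k T - B" using o True by (auto simp: star_family_def)
    qed
    finally show ?thesis .
  qed
  \<comment> \<open>These sets contain neither \<open>i\<close> nor \<open>j\<close>, so the shift
    leaves their membership unchanged.\<close>
  have sumM: "(\<Sum>l\<in>T0. card (M l)) \<le> m" unfolding m_def
  proof (rule sum_missing_links_le[OF _ _ Y(1)])
    show "insert l E \<in> star_family n k T - B" if l: "l \<in> T0" "E \<in> M l" for l E
    proof -
      have E: "E \<in> nsets Y (k - 1)" "insert l E \<notin> \<A>" using l by (auto simp: M_def)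
      have "i \<notin> insert l E" "j \<notin> insert l E" using out(1)[OF _ E(1)] True l by (auto simp: T0_def)
      then have "insert l E \<notin> B" unfolding B_def using mem_shift_iff[OF ij(3), of "insert l E" \<A>] E by auto
      then show ?thesis using out(2)[OF _ E(1), of l] l by (auto simp: star_family_def T0_def)
    qed
    show "M l \<subseteq> nsets Y (k - 1)" for l by (rule sub)
  qed (use T' finm in \<open>auto simp: T0_def Y_def\<close>)
  have near: "card (star_family n k T - \<A>) \<le> 2 * m + card H"
  proof -
    \<comment> \<open>The part of the star closed under replacing \<open>i\<close> by
      \<open>j\<close>; outside it only sets \<open>insert i E\<close> with \<open>E\<close> in the
      link over \<open>Y\<close> remain.\<close>
    define \<S> where "\<S> = {F \<in> star_family n k T. F \<inter> T0 \<noteq> {} \<or> j \<in> F}"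
    have "card (\<S> - \<A>) \<le> card (\<S> - B)" unfolding B_def
    proof (rule missing_shift_mono)
      fix F assume F: "F \<in> \<S>" "i \<in> F" "j \<notin> F"
      then have "F \<subseteq> {1..n}" "finite F" "card F = k" "F \<inter> T0 \<noteq> {}" by (auto simp: \<S>_def star_family_def nsets_def)
      moreover have "card (insert j (F - {i})) = card F"
        using F calculation card_Suc_Diff1[of F i] by simp
      ultimately show "insert j (F - {i}) \<in> \<S>"
        using ij by (auto simp: \<S>_def star_family_def nsets_def T0_def)
    qed (use finite_star ij in \<open>auto simp: \<S>_def\<close>)
    also have "\<dots> \<le> m" unfolding m_def by (rule card_mono[OF finm]) (auto simp: \<S>_def)
    finally have 1: "card (\<S> - \<A>) \<le> m" .
    have "star_family n k T - \<A> \<subseteq> (\<S> - \<A>) \<union> insert i ` (R \<union> H)"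
    proof
      fix F assume F: "F \<in> star_family n k T - \<A>"
      show "F \<in> (\<S> - \<A>) \<union> insert i ` (R \<union> H)"
      proof (cases "F \<in> \<S>")
        case False
        then have "F \<inter> T0 = {}" "j \<notin> F" using F by (auto simp: \<S>_def)
        moreover have N: "F \<subseteq> {1..n}" "finite F" "card F = k" "F \<inter> T \<noteq> {}" using F by (auto simp: star_family_def nsets_def)
        ultimately have "i \<in> F" "F - {i} \<in> nsets Y (k - 1)" by (auto simp: T0_def Y_def nsets_def)
        moreover from this have "insert i (F - {i}) = F" by auto
        ultimately have "F - {i} \<in> R \<union> H" "F = insert i (F - {i})" using F by (auto simp: R_def G_def)
        then show ?thesis by blast
      qed (use F in blast)
    qed
    then have "card (star_family n k T - \<A>) \<le> card ((\<S> - \<A>) \<union> insert i ` (R \<union> H))"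
      using finite_star finite_subset[OF sub(2) finY] finY by (intro card_mono) (auto simp: \<S>_def R_def)
    also have "\<dots> \<le> card (\<S> - \<A>) + card (insert i ` (R \<union> H))" by (rule card_Un_le)
    also have "card (insert i ` (R \<union> H)) \<le> card (R \<union> H)"
      using finite_subset[OF sub(2) finY] finY by (intro card_image_le) (auto simp: R_def)
    also have "card (R \<union> H) \<le> card R + card H" by (rule card_Un_le)
    finally show ?thesis using 1 cR by linarith
  qed
  have near1: "card (star_family n k T1 - \<A>) \<le> 2 * m + card G"
  proof -
    \<comment> \<open>This part of the star of \<open>T1\<close> is also contained in the star of
      \<open>T\<close>, where the missing sets are under control.\<close>
    define \<S> where "\<S> = {F \<in> star_family n k T1. F \<inter> T0 \<noteq> {} \<or> i \<in> F}"
    have "card (\<S> - \<A>) \<le> card (\<S> - B)" unfolding B_def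
    proof (rule missing_shift_mono)
      fix F assume F: "F \<in> \<S>" "i \<in> F" "j \<notin> F"
      then have "F \<subseteq> {1..n}" "finite F" "card F = k" "F \<inter> T0 \<noteq> {}"
        by (auto simp: \<S>_def star_family_def nsets_def T1_def)
      moreover have "card (insert j (F - {i})) = card F"
        using F calculation card_Suc_Diff1[of F i] by simp
      ultimately show "insert j (F - {i}) \<in> \<S>"
        using ij by (auto simp: \<S>_def star_family_def nsets_def T0_def T1_def)
    qed (use finite_star ij in \<open>auto simp: \<S>_def\<close>)
    also have "\<dots> \<le> m" unfolding m_def
      by (rule card_mono[OF finm]) (use True in \<open>auto simp: \<S>_def star_family_def T0_def\<close>)
    finally have 1: "card (\<S> - \<A>) \<le> m" .
    have "star_family n k T1 - \<A> \<subseteq> (\<S> - \<A>) \<union> insert j ` (R \<union> G)"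
    proof
      fix F assume F: "F \<in> star_family n k T1 - \<A>"
      show "F \<in> (\<S> - \<A>) \<union> insert j ` (R \<union> G)"
      proof (cases "F \<in> \<S>")
        case False
        then have "F \<inter> T0 = {}" "i \<notin> F" using F by (auto simp: \<S>_def)
        moreover have N: "F \<subseteq> {1..n}" "finite F" "card F = k" "F \<inter> T1 \<noteq> {}" using F by (auto simp: star_family_def nsets_def)
        ultimately have "j \<in> F" "F - {j} \<in> nsets Y (k - 1)" by (auto simp: T0_def T1_def Y_def nsets_def)
        moreover from this have "insert j (F - {j}) = F" by auto
        ultimately have "F - {j} \<in> R \<union> G" "F = insert j (F - {j})" using F by (auto simp: R_def H_def)
        then show ?thesis by blast
      qed (use F in blast)
    qed
    then have "card (star_family n k T1 - \<A>) \<le> card ((\<S> - \<A>) \<union> insert j ` (R \<union> G))"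
      using finite_star finite_subset[OF sub(1) finY] finY by (intro card_mono) (auto simp: \<S>_def R_def)
    also have "\<dots> \<le> card (\<S> - \<A>) + card (insert j ` (R \<union> G))" by (rule card_Un_le)
    also have "card (insert j ` (R \<union> G)) \<le> card (R \<union> G)"
      using finite_subset[OF sub(1) finY] finY by (intro card_image_le) (auto simp: R_def)
    also have "card (R \<union> G) \<le> card R + card G" by (rule card_Un_le)
    finally show ?thesis using 1 cR by linarith
  qed
  have "t * (k - 1) + (k - 1) \<le> N"
  proof -
    obtain k' where "k = Suc k'" using tk by (cases k) auto
    then show ?thesis using N(2) tk by simp
  qed
  then have "(\<Sum>l\<in>insert j T. k - 1) \<le> card Y" using T' True Y by simp
  then obtain C where C: "\<And>l. l \<in> insert j T \<Longrightarrow> C l \<subseteq> Y" "\<And>l. l \<in> insert j T \<Longrightarrow> card (C l) = k - 1"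
    "\<And>l l'. l \<in> insert j T \<Longrightarrow> l' \<in> insert j T \<Longrightarrow> l \<noteq> l' \<Longrightarrow> C l \<inter> C l' = {}"
    using ex_disjoint_blocks[of "insert j T" Y "\<lambda>_. k - 1"] T'(1) Y(1) by auto
  \<comment> \<open>The points of \<open>T\<close> together with \<open>j\<close> are
    \<open>t + 1\<close> in number, so all their blocks cannot hit the corresponding links at
    once.\<close>
  have pw: "of_bool (\<pi> ` C i \<in> G \<and> \<pi> ` C j \<in> H) \<le> (\<Sum>l\<in>T0. of_bool (\<pi> ` C l \<in> M l) :: real)"
    if \<pi>: "\<pi> permutes Y" for \<pi>
  proof (cases "\<pi> ` C i \<in> G \<and> \<pi> ` C j \<in> H \<and> (\<forall>l\<in>T0. \<pi> ` C l \<notin> M l)")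
    case alltrue: True
    have inj: "inj \<pi>" using \<pi> by (rule permutes_inj)
    have im: "\<pi> ` C l \<in> nsets Y (k - 1)" if "l \<in> insert j T" for l
      using perm_image_nsets[OF \<pi> Y(1) C(1)[OF that]] C(2)[OF that] by simp
    define g where "g l = insert l (\<pi> ` C l)" for l
    have "matching_in \<A> (card (insert j T)) (g ` insert j T)"
    proof (rule matching_in_indexed)
      show "g l \<in> \<A>" if "l \<in> insert j T" for l
      proof -
        have "l = i \<or> l = j \<or> l \<in> T0" using that by (auto simp: T0_def)
        then show ?thesis
          using alltrue im[OF that] by (elim disjE) (auto simp: g_def G_def H_def M_def)
      qed
      show "g l \<inter> g l' = {}" if "l \<in> insert j T" "l' \<in> insert j T" "l \<noteq> l'" for l l'
      proof -
        have "l \<notin> \<pi> ` C l'" "l' \<notin> \<pi> ` C l" using out(1) im that by simp_all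
        moreover have "\<pi> ` C l \<inter> \<pi> ` C l' = {}" using C(3)[OF that] image_Int[OF inj, of "C l" "C l'"] by simp
        ultimately show ?thesis using that(3) by (auto simp: g_def)
      qed
    qed (use T' in \<open>auto simp: g_def\<close>)
    then show ?thesis using nm T' True by simp
  next
    case False
    show ?thesis
    proof (cases "\<pi> ` C i \<in> G \<and> \<pi> ` C j \<in> H")
      case GH: True
      then obtain l where l: "l \<in> T0" "\<pi> ` C l \<in> M l" using False by blast
      have "(1::real) = of_bool (\<pi> ` C l \<in> M l)" using l by simp
      also have "\<dots> \<le> (\<Sum>l\<in>T0. of_bool (\<pi> ` C l \<in> M l))"
        using l(1) T'(1) by (intro member_le_sum) (auto simp: T0_def)
      finally show ?thesis using GH by simp
    next
      case False
      then show ?thesis by (auto intro: sum_nonneg)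
    qed
  qed
  define P where "P = perm_avg Y (\<lambda>\<pi>. of_bool (\<pi> ` C i \<in> G \<and> \<pi> ` C j \<in> H))"
  have "P \<le> (\<Sum>l\<in>T0. perm_avg Y (\<lambda>\<pi>. of_bool (\<pi> ` C l \<in> M l)))"
    unfolding P_def perm_avg_sum[symmetric] by (rule perm_avg_mono) (rule pw)
  also have "\<dots> = (\<Sum>l\<in>T0. real (card (M l)) / real D)"
  proof (rule sum.cong[OF refl])
    fix l assume "l \<in> T0"
    then have l: "l \<in> insert j T" by (auto simp: T0_def)
    show "perm_avg Y (\<lambda>\<pi>. of_bool (\<pi> ` C l \<in> M l)) = real (card (M l)) / real D"
      using perm_avg_single[OF Y(1) C(1)[OF l], of "M l"] C(2)[OF l] sub(3)[of l] by (simp add: set_density_def Y(2) D_def)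
  qed
  also have "\<dots> = real (\<Sum>l\<in>T0. card (M l)) / real D" by (simp add: sum_divide_distrib)
  also have "\<dots> \<le> real m / real D" using sumM by (intro divide_right_mono) (simp_all only: of_nat_le_iff of_nat_0_le_iff)
  also have "\<dots> \<le> 1 / 1000" using m D by (simp add: divide_le_eq)
  finally have P: "P \<le> 1 / 1000" .
  define \<gamma> where "\<gamma> = set_density Y (k - 1) G"
  define h where "h = set_density Y (k - 1) H"
  have dens: "\<gamma> = real (card G) / real D" "h = real (card H) / real D"
    by (simp_all add: \<gamma>_def h_def set_density_def Y(2) D_def)
  have "\<gamma> \<le> 1 / 12 \<or> h \<le> 1 / 12"
  proof (rule link_dichotomy[OF _ P])
    define \<kappa> where "\<kappa> = real (k - 1) * real (k - 1) / (real (N - (k - 1)) * real (N - (k - 1)))"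
    have i: "i \<in> insert j T" "j \<in> insert j T" using True by auto
    show "(P - \<gamma> * h)\<^sup>2 \<le> \<kappa> * (\<gamma> * (1 - \<gamma>)) * (h * (1 - h))"
      unfolding P_def \<gamma>_def h_def \<kappa>_def Y(2)[symmetric]
    proof (rule perm_avg_mixing[OF Y(1)])
      show "k - 1 < card Y" "k - 1 < card Y" using N(1) tk Y(2) by auto
    qed (use C i ij sub in auto)
    show "0 \<le> \<kappa>" by (simp add: \<kappa>_def)
    have q: "2 * real (k - 1) \<le> real (N - (k - 1))" "0 < real (N - (k - 1))" using N(1) tk by auto
    then have "real (k - 1) / real (N - (k - 1)) \<le> 1 / 2" by (simp add: divide_le_eq)
    then have "(real (k - 1) / real (N - (k - 1))) * (real (k - 1) / real (N - (k - 1))) \<le> 1 / 2 * (1 / 2)"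
      by (intro mult_mono) auto
    then show "\<kappa> \<le> 1 / 4" by (simp add: \<kappa>_def)
    show "0 \<le> \<gamma>" "\<gamma> \<le> 1" "0 \<le> h" "h \<le> 1"
      using set_density_nonneg set_density_le_1[OF Y(1)] sub by (auto simp: \<gamma>_def h_def)
    have "D \<le> card R + (card G + card H)"
    proof -
      have "nsets Y (k - 1) = R \<union> (G \<union> H)" using sub by (auto simp: R_def)
      then have "D \<le> card R + card (G \<union> H)" using cY card_Un_le[of R "G \<union> H"] by simp
      then show ?thesis using card_Un_le[of G H] by linarith
    qed
    then have "1000 * D \<le> 1000 * card R + 1000 * (card G + card H)" by simp
    moreover have "1000 * card R \<le> D" using cR m by simp
    ultimately have "1000 * D \<le> D + 1000 * (card G + card H)" by simp
    then have "real (1000 * D) \<le> real (D + 1000 * (card G + card H))" by (simp only: of_nat_le_iff)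
    then have "999 / 1000 \<le> (real (card G) + real (card H)) / real D" using D by (simp add: le_divide_eq)
    then show "1 - \<gamma> - h \<le> 1 / 1000" by (simp add: dens add_divide_distrib)
  qed
  then show ?thesis
  proof
    assume "\<gamma> \<le> 1 / 12"
    \<comment> \<open>The total is at most 1/12 + 2/1000 of \<open>D\<close>, below 1/10.\<close>
    then have "12 * card G \<le> D" using D by (simp add: dens field_simps)
    then have "10 * card (star_family n k T1 - \<A>) \<le> D" using near1 m by linarith
    then show ?thesis using T1 unfolding D_def N_def by blast
  next
    assume "h \<le> 1 / 12"
    then have "12 * card H \<le> D" using D by (simp add: dens field_simps)
    then have "10 * card (star_family n k T - \<A>) \<le> D" using near m by linarith
    then show ?thesis using T unfolding D_def N_def by blast
  qed
qed

section \<open>Stability\<close>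

lemma shifted_missing_star:
  assumes A: "\<A> \<subseteq> nsets {1..n} k" and nm: "\<not> (\<exists>M. matching_in \<A> (t + 1) M)" and sh: "shifted \<A>"
    and pos: "0 < r" "0 < t" "0 < k" and rk: "r \<le> k" and n: "(2 * t + 1) * (k + r - 1) + t + 1 \<le> n"
    and c: "0 \<le> c"
    and big: "real (card (star_family n k {1..t})) - real r * c / real k * real ((n - t - 1) choose (k - 1)) < real (card \<A>)"
  shows "real (card (star_family n k {1..t} - \<A>)) \<le> 5 * c * real ((n - t - 1) choose (k - 1))"
proof -
  define Y where "Y = {t + 2..n}"
  define N where "N = n - t - 1"
  \<comment> \<open>The bound on \<open>n\<close> says that \<open>2 * t + 1\<close> disjoint sets
    of this size fit into \<open>Y\<close>.\<close>
  define b where "b = k + r - 1"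
  define D where "D = real (N choose (k - 1))"
  have Y: "finite Y" "card Y = N" by (auto simp: Y_def N_def)
  have Nb: "(2 * t + 1) * b \<le> N" using n by (simp add: N_def b_def)
  moreover have "b \<le> (2 * t + 1) * b" by simp
  ultimately have bN: "b \<le> N" by (rule order_trans[rotated])
  have kb: "k - 1 < b" "0 < b" using pos by (auto simp: b_def)
  have D: "D > 0" using kb bN by (simp add: D_def)
  define G where "G l = {E \<in> nsets Y (k - 1). insert l E \<in> \<A>}" for l
  define U where "U l = {R \<in> nsets Y b. \<exists>S\<in>G l. S \<subseteq> R}" for l
  have GY: "G l \<subseteq> nsets Y (k - 1)" and UY: "U l \<subseteq> nsets Y b" for l by (auto simp: G_def U_def)
  have finG: "finite (G l)" for l using finite_subset[OF GY finite_imp_finite_nsets[OF Y(1)]] .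
  have Yl: "l \<notin> E" "insert l E \<in> nsets {1..n} k" if "l \<in> {1..t + 1}" "E \<in> nsets Y (k - 1)" for l E
  proof -
    show "l \<notin> E" using that by (auto simp: nsets_def Y_def)
    have "t + 1 \<le> n" using n by simp
    then show "insert l E \<in> nsets {1..n} k" using \<open>l \<notin> E\<close> that pos by (auto simp: nsets_def Y_def)
  qed
  have nested: "G l' \<subseteq> G l" if "1 \<le> l" "l \<le> l'" "l' \<le> t + 1" for l l'
  proof
    fix E assume E: "E \<in> G l'"
    show "E \<in> G l"
    proof (cases "l = l'")
      case False
      have E': "E \<in> nsets Y (k - 1)" "insert l' E \<in> \<A>" using E by (auto simp: G_def)
      have nl: "l \<notin> E" "l' \<notin> E" using Yl(1)[OF _ E'(1)] that by auto
      have "insert l (insert l' E - {l'}) \<in> \<A>"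
        using nl that False by (intro shiftedD[OF sh E'(2)]) auto
      then show ?thesis using E' nl by (simp add: G_def)
    qed (use E in simp)
  qed
  have nestedU: "U l' \<subseteq> U l" if "1 \<le> l" "l \<le> l'" "l' \<le> t + 1" for l l'
    using nested[OF that] unfolding U_def by blast
  define \<gamma> where "\<gamma> l = set_density Y (k - 1) (G l)" for l
  define u where "u l = set_density Y b (U l)" for l
  have cG: "real (card (G l)) = \<gamma> l * D" for l
    using D by (simp add: \<gamma>_def set_density_def Y(2) D_def)
  \<comment> \<open>Disjoint sets from the upper shadows contain disjoint sets from the links, and
    adding the points \<open>1, ..., t + 1\<close> to these gives a forbidden matching. The total
    weight \<open>t + 1\<close> of the last family matches the factor \<open>t + 1\<close> in
    \<open>cB\<close>.\<close>
  have cross: "(\<Sum>l=1..t + 1. u l) + real t * u (t + 1) \<le> real t"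
    unfolding u_def
  proof (rule nested_cross_dependent[OF Y(1)])
    show "(2 * t + 1) * b \<le> card Y" using Nb Y(2) by simp
    show "\<not> (\<exists>f. (\<forall>l\<in>{1..t + 1}. f l \<in> U l) \<and>
        (\<forall>l\<in>{1..t + 1}. \<forall>l'\<in>{1..t + 1}. l \<noteq> l' \<longrightarrow> f l \<inter> f l' = {}))"
    proof
      assume "\<exists>f. (\<forall>l\<in>{1..t + 1}. f l \<in> U l) \<and>
        (\<forall>l\<in>{1..t + 1}. \<forall>l'\<in>{1..t + 1}. l \<noteq> l' \<longrightarrow> f l \<inter> f l' = {})"
      then obtain f where f: "\<forall>l\<in>{1..t + 1}. f l \<in> U l"
        "\<forall>l\<in>{1..t + 1}. \<forall>l'\<in>{1..t + 1}. l \<noteq> l' \<longrightarrow> f l \<inter> f l' = {}" by (elim exE conjE)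
      have "\<forall>l\<in>{1..t + 1}. \<exists>S. S \<in> G l \<and> S \<subseteq> f l" using f(1) by (auto simp: U_def)
      then obtain S where S: "\<forall>l\<in>{1..t + 1}. S l \<in> G l \<and> S l \<subseteq> f l" by (rule bchoice[THEN exE])
      have "matching_in \<A> (card {1..t + 1}) ((\<lambda>l. insert l (S l)) ` {1..t + 1})"
      proof (rule matching_in_indexed)
        show "insert l (S l) \<in> \<A>" if "l \<in> {1..t + 1}" for l using S that by (auto simp: G_def)
        show "insert l (S l) \<inter> insert l' (S l') = {}"
          if l: "l \<in> {1..t + 1}" "l' \<in> {1..t + 1}" "l \<noteq> l'" for l l'
        proof -
          have "S l \<in> nsets Y (k - 1)" "S l' \<in> nsets Y (k - 1)" using S l GY by blast+
          then have "l \<notin> S l'" "l' \<notin> S l" using Yl(1) l by blast+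
          moreover have "S l \<subseteq> f l" "S l' \<subseteq> f l'" "f l \<inter> f l' = {}" using S f(2) l by simp_all
          then have "S l \<inter> S l' = {}" by blast
          ultimately show ?thesis using l(3) by auto
        qed
      qed auto
      then show False using nm by simp
    qed
  qed (use UY nestedU in auto)
  have rng: "0 \<le> \<gamma> l" "\<gamma> l \<le> 1" "0 \<le> u l" "u l \<le> 1" for l
    using set_density_nonneg set_density_le_1[OF Y(1)] GY UY by (auto simp: \<gamma>_def u_def)
  define \<rho> where "\<rho> = real (k - 1) / real b"
  have \<rho>: "0 \<le> \<rho>" "\<rho> \<le> 1" "1 - \<rho> = real r / real b"
    using kb pos by (auto simp: \<rho>_def b_def field_simps of_nat_diff)
  have grow: "\<gamma> l \<le> u l * (\<gamma> l + \<rho> * (1 - \<gamma> l))" for l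
    unfolding \<gamma>_def u_def \<rho>_def U_def
    by (rule upshadow_expansion[OF Y(1) kb(1) _ GY]) (use bN Y in simp)
  have \<gamma>u: "\<gamma> l \<le> u l" for l
  proof -
    have "\<rho> * (1 - \<gamma> l) \<le> 1 * (1 - \<gamma> l)" using \<rho> rng by (intro mult_right_mono) auto
    then have "u l * (\<gamma> l + \<rho> * (1 - \<gamma> l)) \<le> u l * 1" using rng by (intro mult_left_mono) auto
    then show ?thesis using grow[of l] by simp
  qed
  define g where "g = \<gamma> (t + 1)"
  define v where "v = u (t + 1)"
  have split: "(\<Sum>l=1..t + 1. u l) = (\<Sum>l=1..t. u l) + v" by (simp add: v_def)
  have "real t * v \<le> (\<Sum>l=1..t. u l)"
  proof -
    have "(\<Sum>l=1..t. v) \<le> (\<Sum>l=1..t. u l)"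
    proof (rule sum_mono)
      fix l assume "l \<in> {1..t}"
      then have "card (U (t + 1)) \<le> card (U l)"
        using nestedU[of l "t + 1"] finite_subset[OF UY finite_imp_finite_nsets[OF Y(1)]] by (intro card_mono) auto
      then show "v \<le> u l" unfolding v_def u_def set_density_def by (intro divide_right_mono) auto
    qed
    then show ?thesis by simp
  qed
  \<comment> \<open>By nesting \<open>v\<close> is at most each \<open>u l\<close>, so the weighted
    sum is at least \<open>(2 * t + 1) * v\<close>; the resulting \<open>v \<le> 1 / 2\<close> keeps
    \<open>1 - g\<close> away from 0.\<close>
  then have "2 * (real t * v) + v \<le> real t" using cross unfolding split v_def[symmetric] by linarith
  then have "real t * (2 * v) \<le> real t * 1" using rng(3)[of "t + 1"] by (simp add: v_def)
  then have v2: "v \<le> 1 / 2" using pos by (simp add: mult_le_cancel_left_pos)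
  have g2: "g \<le> 1 / 2" using \<gamma>u[of "t + 1"] v2 by (simp add: g_def v_def)
  \<comment> \<open>\<open>grow\<close> rearranges to
    \<open>v - g \<ge> v * (1 - g) * (1 - \<rho>)\<close>. One factor 2 comes from
    \<open>1 - g \<ge> 1 / 2\<close>, the other from \<open>b \<le> 2 * k\<close>, which uses
    \<open>r \<le> k\<close>.\<close>
  have gap: "g * real r / (4 * real k) \<le> v - g"
  proof -
    have "g * (1 / 2) * (real r / (2 * real k)) \<le> v * (1 - g) * (1 - \<rho>)"
    proof (intro mult_mono)
      show "g \<le> v" unfolding g_def v_def by (rule \<gamma>u)
      have "real b \<le> 2 * real k" "0 < real b" using rk pos by (auto simp: b_def)
      then show "real r / (2 * real k) \<le> 1 - \<rho>" unfolding \<rho>(3) by (intro divide_left_mono) auto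
    qed (use g2 v2 rng[of "t + 1"] in \<open>auto simp: g_def v_def\<close>)
    also have "\<dots> \<le> v - g" using grow[of "t + 1"] by (simp add: g_def v_def algebra_simps)
    finally show ?thesis by simp
  qed
  define B where "B = \<A> - star_family n k {1..t}"
  define m where "m = card (star_family n k {1..t} - \<A>)"
  \<comment> \<open>Sets outside the star either contain \<open>t + 1\<close>, and are counted by
    the last link, or lie in \<open>Y\<close>. In the second case shiftedness puts their shadow into
    the last link, and \<open>shifted_shadow\<close> gives the factor \<open>t\<close>.\<close>
  have cB: "real (card B) \<le> real (t + 1) * g * D"
  proof -
    define B0 where "B0 = {F \<in> \<A>. F \<subseteq> Y}"
    have FA: "F \<subseteq> {1..n}" "finite F" "card F = k" if "F \<in> \<A>" for F using that A by (auto simp: nsets_def)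
    have "B \<subseteq> B0 \<union> insert (t + 1) ` G (t + 1)"
    proof
      fix F assume F: "F \<in> B"
      then have FA': "F \<in> \<A>" and "F \<notin> star_family n k {1..t}" by (auto simp: B_def)
      then have "F \<inter> {1..t} = {}" using A by (auto simp: star_family_def)
      then have sub: "F \<subseteq> insert (t + 1) Y"
      proof -
        have "x \<in> insert (t + 1) Y" if "x \<in> F" for x
        proof -
          have "x \<in> {1..n}" "x \<notin> {1..t}" using that FA(1)[OF FA'] \<open>F \<inter> {1..t} = {}\<close> by auto
          then show ?thesis by (auto simp: Y_def)
        qed
        then show ?thesis by blast
      qed
      show "F \<in> B0 \<union> insert (t + 1) ` G (t + 1)"
      proof (cases "t + 1 \<in> F")
        case True
        then have e: "insert (t + 1) (F - {t + 1}) = F" by auto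
        have "F - {t + 1} \<in> nsets Y (k - 1)" using sub FA[OF FA'] True by (auto simp: nsets_def)
        then have "F - {t + 1} \<in> G (t + 1)" using e FA' by (simp add: G_def)
        then show ?thesis using e by (metis UnCI imageI)
      next
        case False
        then show ?thesis using sub FA' by (auto simp: B0_def)
      qed
    qed
    moreover have "finite \<A>" using finite_subset[OF A finite_imp_finite_nsets] by simp
    then have "finite B0" by (simp add: B0_def)
    ultimately have "card B \<le> card B0 + card (insert (t + 1) ` G (t + 1))"
      using finG card_mono[of "B0 \<union> insert (t + 1) ` G (t + 1)" B] card_Un_le[of B0 "insert (t + 1) ` G (t + 1)"] by simp
    also have "card (insert (t + 1) ` G (t + 1)) \<le> card (G (t + 1))" by (rule card_image_le[OF finG])
    also have "card B0 \<le> t * card (G (t + 1))"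
    proof (rule shifted_shadow[OF A sh nm pos(3) _ finG])
      show "B0 \<subseteq> \<A>" by (auto simp: B0_def)
      fix F x assume F: "F \<in> B0" "x \<in> F"
      then have x: "F \<in> \<A>" "t + 1 < x" "t + 1 \<notin> F" "F \<subseteq> Y" by (auto simp: B0_def Y_def)
      then have "insert (t + 1) (F - {x}) \<in> \<A>" using F(2) by (intro shiftedD[OF sh]) auto
      moreover have "F - {x} \<in> nsets Y (k - 1)" using x F(2) FA[OF x(1)] by (auto simp: nsets_def)
      ultimately show "F - {x} \<in> G (t + 1)" by (simp add: G_def)
    qed
    finally have "card B \<le> (t + 1) * card (G (t + 1))" by simp
    then have "real (card B) \<le> real ((t + 1) * card (G (t + 1)))" by (simp only: of_nat_le_iff)
    then show ?thesis unfolding of_nat_mult cG g_def by (simp only: mult.assoc)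
  qed
  have cM: "(\<Sum>l=1..t. 1 - \<gamma> l) * D \<le> real m"
  proof -
    have "(\<Sum>l\<in>{1..t}. card (nsets Y (k - 1) - G l)) \<le> m" unfolding m_def
    proof (rule sum_missing_links_le[OF _ order_refl Y(1)])
      show "insert l E \<in> star_family n k {1..t} - \<A>" if "l \<in> {1..t}" "E \<in> nsets Y (k - 1) - G l" for l E
        using that Yl[of l E] by (auto simp: G_def star_family_def)
      show "nsets Y (k - 1) - G l \<subseteq> nsets Y (k - 1)" for l by blast
    qed (auto simp: Y_def finite_star)
    then have "real (\<Sum>l\<in>{1..t}. card (nsets Y (k - 1) - G l)) \<le> real m" by (simp only: of_nat_le_iff)
    moreover have "real (card (nsets Y (k - 1) - G l)) = (1 - \<gamma> l) * D" for l
    proof -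
      have "card (nsets Y (k - 1) - G l) = card (nsets Y (k - 1)) - card (G l)"
        by (rule card_Diff_subset[OF finG GY])
      moreover have "card (G l) \<le> card (nsets Y (k - 1))" by (rule card_mono[OF finite_imp_finite_nsets[OF Y(1)] GY])
      ultimately have "real (card (nsets Y (k - 1) - G l)) = D - real (card (G l))"
        by (simp add: of_nat_diff card_nsets Y(2) D_def)
      then show ?thesis unfolding cG by (simp add: algebra_simps)
    qed
    ultimately show ?thesis by (simp add: sum_distrib_right)
  qed
  have cA: "real (card \<A>) = real (card (star_family n k {1..t})) + real (card B) - real m"
  proof -
    have fA: "finite \<A>" using finite_subset[OF A finite_imp_finite_nsets] by simp
    have "card \<A> = card (\<A> \<inter> star_family n k {1..t}) + card B"
      unfolding B_def using fA by (metis card_Int_Diff)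
    moreover have "card (star_family n k {1..t}) = card (\<A> \<inter> star_family n k {1..t}) + m"
      unfolding m_def using finite_star by (metis card_Int_Diff inf_commute)
    ultimately show ?thesis by simp
  qed
  define \<epsilon> where "\<epsilon> = real r * c / real k"
  have ex: "real m - real (card B) < \<epsilon> * D"
    using big cA by (simp add: \<epsilon>_def D_def N_def)
  \<comment> \<open>Here \<open>v\<close> comes from \<open>cross\<close> and \<open>g\<close> from
    \<open>cB\<close>; their difference is the surplus to be compared with
    \<open>\<epsilon>\<close>.\<close>
  have "real (t + 1) * (v - g) \<le> (\<Sum>l=1..t. 1 - \<gamma> l) - real (t + 1) * g"
  proof -
    have "(\<Sum>l=1..t. \<gamma> l) \<le> (\<Sum>l=1..t. u l)" by (rule sum_mono) (rule \<gamma>u)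
    moreover have "(\<Sum>l=1..t. u l) \<le> real t - real (t + 1) * v"
      using cross unfolding split v_def[symmetric] by (simp add: algebra_simps)
    ultimately show ?thesis by (simp add: sum_subtractf algebra_simps)
  qed
  then have "real (t + 1) * (v - g) * D \<le> ((\<Sum>l=1..t. 1 - \<gamma> l) - real (t + 1) * g) * D"
    using D by (intro mult_right_mono) auto
  also have "\<dots> \<le> real m - real (card B)" using cM cB by (simp add: left_diff_distrib)
  also have "\<dots> < \<epsilon> * D" by (rule ex)
  finally have "real (t + 1) * (v - g) < \<epsilon>" using D by (simp only: mult_less_cancel_right_pos)
  moreover have "real (t + 1) * (g * real r / (4 * real k)) \<le> real (t + 1) * (v - g)"
    using gap by (intro mult_left_mono) auto
  ultimately have "real (t + 1) * (g * real r / (4 * real k)) < real r * c / real k" unfolding \<epsilon>_def by linarith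
  moreover have "real (t + 1) * (g * real r / (4 * real k)) = (real (t + 1) * g) * (real r / real k) / 4"
    using pos by (simp add: field_simps)
  moreover have "real r * c / real k = c * (real r / real k)" by simp
  ultimately have "(real (t + 1) * g) * (real r / real k) / 4 < c * (real r / real k)" by (simp only:)
  then have "(real (t + 1) * g) * (real r / real k) < (4 * c) * (real r / real k)"
    unfolding divide_less_eq_numeral1(1) mult.assoc[of 4] by (simp only: mult.commute)
  moreover have rk0: "0 < real r / real k" using pos by simp
  ultimately have tg: "real (t + 1) * g < 4 * c" by (simp only: mult_less_cancel_right_pos)
  have "\<epsilon> \<le> c"
  proof -
    have "real r / real k * c \<le> 1 * c" using rk pos c by (intro mult_right_mono) auto
    then show ?thesis by (simp add: \<epsilon>_def)
  qed
  have "real m \<le> (real (t + 1) * g + \<epsilon>) * D" using ex cB by (simp add: distrib_right)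
  also have "\<dots> \<le> (5 * c) * D" using tg \<open>\<epsilon> \<le> c\<close> D by (intro mult_right_mono) auto
  finally show ?thesis by (simp add: m_def D_def N_def)
qed

text \<open>By \<open>star_bootstrap\<close> the sets outside replace at most two thirds of the
  missing ones, so a third of the missing number is a genuine deficit, smaller than
  \<open>x\<close>.\<close>

lemma missing_star_bound:
  assumes A: "\<A> \<subseteq> nsets {1..n} k" and nm: "\<not> (\<exists>M. matching_in \<A> (t + 1) M)"
    and T: "T \<in> nsets {1..n} t" and tk: "0 < t" "0 < k" and n: "(2 * t + 1) * k + t \<le> n"
    and big: "real (card (star_family n k T)) - x < real (card \<A>)"
    and small: "10 * card (star_family n k T - \<A>) \<le> (n - t - 1) choose (k - 1)"
  shows "real (card (star_family n k T - \<A>)) < 3 * x"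
proof -
  let ?S = "star_family n k T"
  have fA: "finite \<A>" using finite_subset[OF A finite_imp_finite_nsets] by simp
  have "card \<A> = card (\<A> \<inter> ?S) + card (\<A> - ?S)" using fA by (metis card_Int_Diff)
  moreover have "card ?S = card (\<A> \<inter> ?S) + card (?S - \<A>)" using finite_star by (metis card_Int_Diff inf_commute)
  moreover have "3 * card (\<A> - ?S) \<le> 2 * card (?S - \<A>)" by (rule star_bootstrap[OF A nm T tk n small])
  ultimately show ?thesis using big by linarith
qed

text \<open>Shifting keeps the cardinality and creates no larger matching, so every family on the
  way to a shifted one satisfies the same hypotheses; the statement is thus pulled back along the
  shifts.\<close>

lemma ex_near_star:
  assumes "\<A> \<subseteq> nsets {1..n} k" and "\<not> (\<exists>M. matching_in \<A> (t + 1) M)"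
    and pos: "0 < r" "0 < t" "0 < k" and rk: "r \<le> k" and n: "(2 * t + 1) * (k + r - 1) + t + 1 \<le> n"
    and c: "0 \<le> c" "5000 * c \<le> 1"
    and "real (n choose k) - real ((n - t) choose k) - real r * c / real k * real ((n - t - 1) choose (k - 1))
           < real (card \<A>)"
  shows "\<exists>T\<in>nsets {1..n} t. 1000 * card (star_family n k T - \<A>) \<le> (n - t - 1) choose (k - 1)"
  using assms(1,2,10)
proof (induction "family_weight \<A>" arbitrary: \<A> rule: less_induct)
  case less
  define D where "D = real ((n - t - 1) choose (k - 1))"
  have n': "(2 * t + 1) * k + t \<le> n"
  proof -
    have "(2 * t + 1) * k \<le> (2 * t + 1) * (k + r - 1)" using pos by (intro mult_le_mono2) auto
    then show ?thesis using n by linarith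
  qed
  show ?case
  proof (cases "shifted \<A>")
    case True
    have T: "{1..t} \<in> nsets {1..n} t" using n by (auto simp: nsets_def)
    have "real (card (star_family n k {1..t} - \<A>)) \<le> 5 * c * D"
      unfolding D_def
      by (rule shifted_missing_star[OF less(2,3) True pos rk n c(1)]) (use less(4) card_star[OF T] in simp)
    \<comment> \<open>The bound \<open>5 * c\<close> of the shifted case has to be at most 1/1000,
      which is the origin of \<open>5000 * c \<le> 1\<close>.\<close>
    then have "1000 * real (card (star_family n k {1..t} - \<A>)) \<le> 5000 * c * D" by linarith
    also have "\<dots> \<le> 1 * D" using c by (intro mult_right_mono) (auto simp: D_def)
    finally have "1000 * card (star_family n k {1..t} - \<A>) \<le> (n - t - 1) choose (k - 1)"
      unfolding D_def by linarith
    then show ?thesis using T by blast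
  next
    case False
    then obtain i j where ij: "0 < i" "i < j" "j \<le> n" "shift \<A> i j \<noteq> \<A>"
      using shifted_if_shift_eq[OF less(2)] by blast
    have fin: "finite \<A>" "finite F" if "F \<in> \<A>" for F
      using finite_subset[OF less(2) finite_imp_finite_nsets] less(2) that by (auto simp: nsets_def)
    have "\<A> \<noteq> {}" using ij(4) by (auto simp: shift_def)
    then have finA: "finite \<A>" using fin by blast
    have "family_weight (shift \<A> i j) < family_weight \<A>"
      by (rule family_weight_shift_less[OF finA fin(2) ij(2,4)])
    moreover have "shift \<A> i j \<subseteq> nsets {1..n} k" by (rule shift_subset_nsets[OF less(2)]) (use ij in simp)
    moreover have "\<not> (\<exists>M. matching_in (shift \<A> i j) (t + 1) M)"
      using less(3) matching_in_shift[of i j \<A> "t + 1"] ij by auto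
    ultimately obtain T where T: "T \<in> nsets {1..n} t"
      "1000 * card (star_family n k T - shift \<A> i j) \<le> (n - t - 1) choose (k - 1)"
      using less(1)[of "shift \<A> i j"] less(4) by (auto simp: card_shift)
    obtain T' where T': "T' \<in> nsets {1..n} t"
      "10 * card (star_family n k T' - \<A>) \<le> (n - t - 1) choose (k - 1)"
      using shift_dichotomy[OF less(2,3) T(1) pos(2,3) n' _ _ _ T(2)] ij by auto
    \<comment> \<open>The rough precision 1/10 suffices for the bootstrap, which returns
      \<open>3 * c\<close>, again below 1/1000, so the induction closes with an unchanged
      constant.\<close>
    have "real (card (star_family n k T' - \<A>)) < 3 * (real r * c / real k * D)"
    proof (rule missing_star_bound[OF less(2,3) T'(1) pos(2,3) n' _ T'(2)])
      show "real (card (star_family n k T')) - real r * c / real k * D < real (card \<A>)"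
        using less(4) card_star[OF T'(1)] by (simp add: D_def)
    qed
    also have "\<dots> \<le> 3 * (c * D)"
    proof -
      have "real r / real k * (c * D) \<le> 1 * (c * D)" using rk pos c by (intro mult_right_mono) (auto simp: D_def)
      then show ?thesis by simp
    qed
    finally have "1000 * real (card (star_family n k T' - \<A>)) \<le> 3000 * c * D" by linarith
    also have "\<dots> \<le> 1 * D" using c by (intro mult_right_mono) (auto simp: D_def)
    finally have "1000 * card (star_family n k T' - \<A>) \<le> (n - t - 1) choose (k - 1)"
      unfolding D_def by linarith
    then show ?thesis using T'(1) by blast
  qed
qed

theorem theorem1p6:
  fixes \<delta> c :: real and r t k n :: nat and \<A> :: "nat set set"
  assumes "0 < \<delta>" and "\<delta> < 1/4"
    and "c = \<delta> / 10 ^ 10"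
    and "0 < r" and "0 < t" and "0 < k" and "0 < n"
    and "r \<le> k"
    and "int n > (2 * int t + 1) * (int k + int r) - int t"
    and "\<A> \<subseteq> nsets {1..n} k"
    and "\<not> (\<exists>M. matching_in \<A> (t + 1) M)"
    and "real (card \<A>) >
           real (n choose k) - (1 + real r * c / real n) * real ((n - t) choose k)"
  shows "\<exists>T \<in> nsets {1..n} t.
           real (card (sym_diff \<A> (star_family n k T)))
             < 3 * \<delta> * real ((n - t - 1) choose (k - 1))"
proof -
  define D where "D = real ((n - t - 1) choose (k - 1))"
  \<comment> \<open>The second bound feeds \<open>ex_near_star\<close>, the third the final
    estimate.\<close>
  have c: "0 < c" "5000 * c \<le> 1" "18 * c < 3 * \<delta>" using assms(1-3) by auto
  \<comment> \<open>The integer form of the bound on \<open>n\<close>, rewritten as room for the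
    blocks: the subtracted \<open>t\<close> turns into \<open>t + 1\<close> points outside
    \<open>Y\<close>.\<close>
  have n: "(2 * t + 1) * (k + r - 1) + t + 1 \<le> n"
  proof -
    have "int ((2 * t + 1) * (k + r - 1) + t + 1) = (2 * int t + 1) * (int k + int r) - int t"
    proof -
      have "int (k + r - 1) = int k + int r - 1" using assms(4) by (simp add: of_nat_diff)
      then show ?thesis unfolding of_nat_add of_nat_mult by (simp add: algebra_simps)
    qed
    then show ?thesis using assms(9) by linarith
  qed
  have n': "(2 * t + 1) * k + t \<le> n"
  proof -
    have "(2 * t + 1) * k \<le> (2 * t + 1) * (k + r - 1)" using assms(4) by (intro mult_le_mono2) auto
    then show ?thesis using n by linarith
  qed
  have "k \<le> (2 * t + 1) * k" by simp
  then have kn: "k - 1 \<le> n - t - 1" using n' by linarith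
  then have D: "D > 0" by (simp add: D_def)
  \<comment> \<open>Absorption gives \<open>(n - t) choose k\<close> as \<open>(n - t) / k\<close>
    times \<open>D\<close>, and \<open>(n - t) / n \<le> 1\<close>; this changes the unit of the
    error term.\<close>
  have "real r * c / real n * real ((n - t) choose k) \<le> real r * c / real k * D"
  proof -
    have "k * ((n - t) choose k) = (n - t) * ((n - t - 1) choose (k - 1))"
      by (rule times_binomial_minus1_eq[OF assms(6)])
    then have "real k * real ((n - t) choose k) = real (n - t) * D" unfolding D_def by (metis of_nat_mult)
    then have e: "real ((n - t) choose k) = real (n - t) * D / real k" using assms(6) by (simp add: field_simps)
    have "real (n - t) / real n \<le> 1" by (simp add: divide_le_eq)
    then have "(real r * c / real k * D) * (real (n - t) / real n) \<le> (real r * c / real k * D) * 1"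
      using c D by (intro mult_left_mono) auto
    then show ?thesis unfolding e by (simp add: mult_ac)
  qed
  then have big: "real (n choose k) - real ((n - t) choose k) - real r * c / real k * D < real (card \<A>)"
    using assms(12) by (simp add: algebra_simps)
  obtain T where T: "T \<in> nsets {1..n} t" "1000 * card (star_family n k T - \<A>) \<le> (n - t - 1) choose (k - 1)"
    using ex_near_star[OF assms(10,11,4,5,6,8) n _ c(2)] c(1) big by (auto simp: D_def)
  let ?S = "star_family n k T"
  have T10: "10 * card (?S - \<A>) \<le> (n - t - 1) choose (k - 1)" using T(2) by linarith
  have "real (card (?S - \<A>)) < 3 * (real r * c / real k * D)"
    by (rule missing_star_bound[OF assms(10,11) T(1) assms(5,6) n' _ T10]) (use big card_star[OF T(1)] in simp)
  also have "\<dots> \<le> 3 * (c * D)"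
  proof -
    have "real r / real k * (c * D) \<le> 1 * (c * D)" using assms(6,8) c D by (intro mult_right_mono) auto
    then show ?thesis by simp
  qed
  finally have S: "real (card (?S - \<A>)) < 3 * (c * D)" .
  have B: "3 * card (\<A> - ?S) \<le> 2 * card (?S - \<A>)"
    by (rule star_bootstrap[OF assms(10,11) T(1) assms(5,6) n' T10])
  have "card (sym_diff \<A> ?S) \<le> card (\<A> - ?S) + card (?S - \<A>)" by (rule card_Un_le)
  \<comment> \<open>Less than \<open>3 * c * D\<close> missing sets and at most two thirds as many
    outside stay below \<open>6 * c * D\<close>.\<close>
  then have "real (card (sym_diff \<A> ?S)) < 6 * (c * D)" using S B by linarith
  also have "\<dots> \<le> 18 * c * D" using c D by simp
  also have "\<dots> \<le> 3 * \<delta> * D" using c(3) D by (intro mult_right_mono) auto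
  finally show ?thesis using T(1) unfolding D_def by blast
qed

end
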